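(* Fix an integer $\Delta\ge3$, a real $\lambda\ge1$ and $\kappa\in(1,\Delta/2]$. Let $$\beta=\tfrac12\,e^{-\left(1+\frac{2}{\kappa-1}\right)}\left(\frac{\Delta}{2\kappa}\right)^{-\left(1+\frac{1}{\kappa-1}\right)},$$ and let $q\ge2$ be an integer satisfying $q-1\le\frac{\beta^2}{256e^2}\lambda^{\Delta-\kappa-\frac{\kappa^2}{\Delta-\kappa}}$. Let $G$ be uniformly random in $\mathcal{G}_{n,\Delta}$. Then asymptotically almost surely the Glauber dynamics $\mathcal{M}=\mathcal{M}_{\mathrm{GD}}(G,\lambda,q)$ satisfies $\tau(\mathcal{M})\ge2^{\beta n-4}$.
   Context: Potts model on $G=(V,E)$: configurations $\sigma\in[q]^V$, $\mu(\sigma)$ = number of monochromatic edges, Gibbs distribution $\pi(\sigma)\propto\lambda^{\mu(\sigma)}$. Glauber dynamics $\mathcal{M}_{\mathrm{GD}}(G,\lambda,q)$: from $X_t$ choose a uniformly random vertex $v$, choose $c\in[q]$ with probability proportional to $\lambda^{n(X_t,v,c)}$ ($n(X,v,c)$ = number of neighbours of $v$ coloured $c$ in $X$), and recolour $v$ with $c$. $\tau(\mathcal{M})=\max_x\min\{t:\|P^t(x,\cdot)-\pi\|_{TV}\le 1/(2e)\}$. $\mathcal{G}_{n,\Delta}$ is the uniform probability space of $\Delta$-regular simple graphs on $\{1,\dots,n\}$ ($n$ even if $\Delta$ odd); asymptotically almost surely means with probability tending to $1$ as $n\to\infty$. *)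

theory Defs
  imports "HOL-Analysis.Analysis" "HOL-Library.FuncSet"
begin

text \<open>A simple graph on vertex set {0..<n} is given by its set of edges, each edge
a two-element subset of {0..<n}.\<close>

definition degree :: "nat set set \<Rightarrow> nat \<Rightarrow> nat" where
  "degree E v = card {u. {u, v} \<in> E}"

definition regular_graphs :: "nat \<Rightarrow> nat \<Rightarrow> nat set set set" where
  "regular_graphs n \<Delta> =
     {E. E \<subseteq> {{u, v} | u v. u < n \<and> v < n \<and> u \<noteq> v} \<and> (\<forall>v<n. degree E v = \<Delta>)}"

definition aas_regular :: "nat \<Rightarrow> (nat \<Rightarrow> nat set set \<Rightarrow> bool) \<Rightarrow> bool" where
  "aas_regular \<Delta> P \<longleftrightarrow>
     (\<forall>\<epsilon>>0. \<exists>N. \<forall>n\<ge>N. even (n * \<Delta>) \<longrightarrow>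
        real (card {E \<in> regular_graphs n \<Delta>. P n E}) / real (card (regular_graphs n \<Delta>))
          \<ge> 1 - \<epsilon>)"

definition configs :: "nat \<Rightarrow> nat \<Rightarrow> (nat \<Rightarrow> nat) set" where
  "configs n q = PiE {0..<n} (\<lambda>_. {0..<q})"

definition mono_edges :: "nat set set \<Rightarrow> (nat \<Rightarrow> nat) \<Rightarrow> nat" where
  "mono_edges E \<sigma> = card {e \<in> E. \<exists>c. \<forall>v\<in>e. \<sigma> v = c}"

definition gibbs :: "nat \<Rightarrow> nat set set \<Rightarrow> real \<Rightarrow> nat \<Rightarrow> (nat \<Rightarrow> nat) \<Rightarrow> real" where
  "gibbs n E lam q \<sigma> =
     lam ^ mono_edges E \<sigma> / (\<Sum>\<tau>\<in>configs n q. lam ^ mono_edges E \<tau>)"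

definition nbr_count :: "nat set set \<Rightarrow> (nat \<Rightarrow> nat) \<Rightarrow> nat \<Rightarrow> nat \<Rightarrow> nat" where
  "nbr_count E X v c = card {u. {u, v} \<in> E \<and> X u = c}"

definition glauber_P ::
  "nat \<Rightarrow> nat set set \<Rightarrow> real \<Rightarrow> nat \<Rightarrow> (nat \<Rightarrow> nat) \<Rightarrow> (nat \<Rightarrow> nat) \<Rightarrow> real" where
  "glauber_P n E lam q X Y =
     (\<Sum>v<n. \<Sum>c<q.
        (if X(v := c) = Y then
           (1 / real n) * (lam ^ nbr_count E X v c / (\<Sum>c'<q. lam ^ nbr_count E X v c'))
         else 0))"

fun glauber_Pt ::
  "nat \<Rightarrow> nat set set \<Rightarrow> real \<Rightarrow> nat \<Rightarrow> nat \<Rightarrow> (nat \<Rightarrow> nat) \<Rightarrow> (nat \<Rightarrow> nat) \<Rightarrow> real" where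
  "glauber_Pt n E lam q 0 X Y = (if X = Y then 1 else 0)"
| "glauber_Pt n E lam q (Suc t) X Y =
     (\<Sum>Z\<in>configs n q. glauber_Pt n E lam q t X Z * glauber_P n E lam q Z Y)"

definition tv_dist :: "nat \<Rightarrow> nat set set \<Rightarrow> real \<Rightarrow> nat \<Rightarrow> nat \<Rightarrow> (nat \<Rightarrow> nat) \<Rightarrow> real" where
  "tv_dist n E lam q t X =
     (1 / 2) * (\<Sum>Y\<in>configs n q. \<bar>glauber_Pt n E lam q t X Y - gibbs n E lam q Y\<bar>)"

text \<open>Mixing time tau(M) = max_x min{t : ||P^t(x,.) - pi||_TV <= 1/(2e)}
  (as an extended real; the min of an empty set is +infinity).\<close>
definition mixing_time :: "nat \<Rightarrow> nat set set \<Rightarrow> real \<Rightarrow> nat \<Rightarrow> ereal" where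
  "mixing_time n E lam q =
     (SUP X\<in>configs n q. INF t\<in>{t. tv_dist n E lam q t X \<le> 1 / (2 * exp 1)}. ereal (real t))"

end

theory Submission
  imports Defs "HOL-Real_Asymp.Real_Asymp"
begin

text \<open>
  Let \<open>k = \<lceil>\<beta> n\<rceil>\<close> and let \<open>S\<close> be the set of configurations in which at most \<open>k\<close> vertices
  have a colour other than \<open>0\<close>. The chain can leave \<open>S\<close> only through the layer of configurations
  with exactly \<open>k\<close> such vertices, and \<open>S\<close> has stationary mass at most \<open>1/2\<close> by colour symmetry,
  so the mixing time is at least of the order of the mass of \<open>S\<close> divided by that of the layer.

  If every set \<open>U\<close> of \<open>k\<close> vertices spans at most \<open>\<kappa> k\<close> edges, the layer is light. Relative to the
  constant configuration, the configurations whose non-\<open>0\<close> vertices are exactly \<open>U\<close> have weight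
  \<open>\<lambda>^(e(U) - \<Delta> k)\<close> times the Potts partition function of \<open>U\<close> with \<open>Q = q - 1\<close> colours. Colouring
  the vertices of \<open>U\<close> one at a time, a vertex with \<open>d\<close> earlier neighbours contributes a factor at
  most \<open>Q - 1 + \<lambda>^d \<le> 2 Q^(1 - d/\<Delta>) \<lambda>^d\<close>. The product of these factors is governed by \<open>e(U)\<close>
  alone, and this is where the exponent \<open>\<Delta> - \<kappa> - \<kappa>\<^sup>2/(\<Delta> - \<kappa>)\<close> comes from.

  Almost all regular graphs have this sparsity property by a first-moment bound. Switching an edge
  \<open>uv\<close> with a far-away edge \<open>xy\<close> compares the number of regular graphs containing \<open>M\<close> and \<open>uv\<close> with
  the number of those containing \<open>M\<close>. Iterating this bounds the binomial moments of \<open>e(U)\<close> by their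
  values in the configuration model up to a bounded factor, so the configuration model itself is
  not needed.
\<close>

section \<open>Edge sets of simple graphs and of regular graphs\<close>

definition simple_edges :: "nat set set \<Rightarrow> bool" where
  "simple_edges E \<longleftrightarrow> finite E \<and> (\<forall>e\<in>E. card e = 2)"

definition inner_edges :: "nat set set \<Rightarrow> nat set \<Rightarrow> nat set set" where
  "inner_edges E U = {e \<in> E. e \<subseteq> U}"

lemma simple_edges_finite: "simple_edges E \<Longrightarrow> finite E"
  and simple_edges_card: "simple_edges E \<Longrightarrow> e \<in> E \<Longrightarrow> card e = 2"
  by (auto simp: simple_edges_def)

lemma simple_edges_irrefl: "simple_edges E \<Longrightarrow> {v, v} \<notin> E"
  by (auto dest: simple_edges_card)

lemma simple_edges_subset: "simple_edges E \<Longrightarrow> F \<subseteq> E \<Longrightarrow> simple_edges F"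
  unfolding simple_edges_def using finite_subset by blast

lemma finite_inner_edges: "simple_edges E \<Longrightarrow> finite (inner_edges E U)"
  by (simp add: inner_edges_def simple_edges_finite)

lemma bij_betw_nbrs_incident:
  assumes "simple_edges E"
  shows "bij_betw (\<lambda>u. {u, v}) {u. {u, v} \<in> E} {e \<in> E. v \<in> e}"
proof (rule bij_betw_imageI)
  show "inj_on (\<lambda>u. {u, v}) {u. {u, v} \<in> E}"
    by (rule inj_onI) (auto simp: doubleton_eq_iff)
  show "(\<lambda>u. {u, v}) ` {u. {u, v} \<in> E} = {e \<in> E. v \<in> e}"
  proof (intro subset_antisym subsetI)
    fix e assume e: "e \<in> {e \<in> E. v \<in> e}"
    then have "card e = 2" using assms simple_edges_card by blast
    then obtain a b where "e = {a, b}" by (auto simp: card_2_iff)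
    then have "\<exists>u. e = {u, v}" using e by auto
    then show "e \<in> (\<lambda>u. {u, v}) ` {u. {u, v} \<in> E}" using e by auto
  qed auto
qed

lemma degree_eq_card_incident:
  assumes "simple_edges E"
  shows "degree E v = card {e \<in> E. v \<in> e}"
  unfolding degree_def using bij_betw_same_card[OF bij_betw_nbrs_incident[OF assms]] .

lemma finite_nbrs:
  assumes "simple_edges E"
  shows "finite {u. {u, v} \<in> E}"
  using bij_betw_finite[OF bij_betw_nbrs_incident[OF assms]] simple_edges_finite[OF assms] by simp

lemma sum_degree_eq:
  assumes "simple_edges E" "finite U"
  shows "(\<Sum>v\<in>U. degree E v) = (\<Sum>e\<in>E. card (e \<inter> U))"
proof -
  have fE: "finite E" using assms simple_edges_finite by blast
  have "(\<Sum>v\<in>U. degree E v) = (\<Sum>v\<in>U. \<Sum>e\<in>E. if v \<in> e then 1 else 0)"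
    by (intro sum.cong refl) (simp add: degree_eq_card_incident[OF assms(1)] sum.If_cases fE Int_def)
  also have "\<dots> = (\<Sum>e\<in>E. \<Sum>v\<in>U. if v \<in> e then 1 else 0)" by (rule sum.swap)
  also have "\<dots> = (\<Sum>e\<in>E. card (e \<inter> U))"
    by (intro sum.cong refl) (simp add: sum.If_cases assms Int_commute)
  finally show ?thesis .
qed

lemma sum_degree_subset:
  assumes "simple_edges M" "finite U" "\<And>e. e \<in> M \<Longrightarrow> e \<subseteq> U"
  shows "(\<Sum>v\<in>U. degree M v) = 2 * card M"
proof -
  have "(\<Sum>e\<in>M. card (e \<inter> U)) = (\<Sum>e\<in>M. 2)"
    using assms by (intro sum.cong refl) (simp add: Int_absorb2 simple_edges_card)
  then show ?thesis using sum_degree_eq[OF assms(1,2)] by simp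
qed

text \<open>The identity holds edge by edge: \<open>[e \<subseteq> V - U] + card (e \<inter> U) = 1
  + [e \<subseteq> U]\<close>, whether \<open>e\<close> has 0, 1 or 2 ends in \<open>U\<close>. The
  additive form avoids truncated subtraction of naturals.\<close>

lemma inner_edges_complement:
  assumes "simple_edges E" "finite V" "\<And>e. e \<in> E \<Longrightarrow> e \<subseteq> V" "U \<subseteq> V"
  shows "card (inner_edges E (V - U)) + (\<Sum>v\<in>U. degree E v) = card E + card (inner_edges E U)"
proof -
  have fE: "finite E" using assms simple_edges_finite by blast
  have fU: "finite U" using assms finite_subset by blast
  have ind: "card (inner_edges E W) = (\<Sum>e\<in>E. if e \<subseteq> W then 1 else 0)" for W
    by (simp add: inner_edges_def sum.If_cases fE Int_def)
  have "(if e \<subseteq> V - U then 1 else 0) + card (e \<inter> U) = 1 + (if e \<subseteq> U then 1 else 0)" if e: "e \<in> E" for e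
  proof -
    have "card e = 2" "e \<subseteq> V" using assms e simple_edges_card by auto
    then obtain a b where ab: "e = {a, b}" "a \<noteq> b" by (auto simp: card_2_iff)
    show ?thesis using \<open>e \<subseteq> V\<close> ab by (cases "a \<in> U"; cases "b \<in> U") (auto simp: Int_insert_left)
  qed
  then have "(\<Sum>e\<in>E. (if e \<subseteq> V - U then 1 else 0) + card (e \<inter> U)) =
      (\<Sum>e\<in>E. 1 + (if e \<subseteq> U then 1 else 0))"
    by (intro sum.cong refl) blast
  then show ?thesis
    by (simp only: ind sum_degree_eq[OF assms(1) fU] sum.distrib card_eq_sum[of E])
qed

lemma regular_graphs_simple: "E \<in> regular_graphs n \<Delta> \<Longrightarrow> simple_edges E"
proof -
  assume E: "E \<in> regular_graphs n \<Delta>"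
  then have sub: "E \<subseteq> {{u, v} | u v. u < n \<and> v < n \<and> u \<noteq> v}" by (auto simp: regular_graphs_def)
  also have "\<dots> \<subseteq> Pow {..<n}" by auto
  finally have "finite E" using finite_subset by blast
  with sub show ?thesis by (auto simp: simple_edges_def)
qed

lemma regular_graphs_edge_subset: "E \<in> regular_graphs n \<Delta> \<Longrightarrow> e \<in> E \<Longrightarrow> e \<subseteq> {..<n}"
  by (auto simp: regular_graphs_def)

lemma regular_graphs_degree: "E \<in> regular_graphs n \<Delta> \<Longrightarrow> v < n \<Longrightarrow> degree E v = \<Delta>"
  by (auto simp: regular_graphs_def)

lemma regular_graphsI:
  assumes "simple_edges E" "\<And>e. e \<in> E \<Longrightarrow> e \<subseteq> {..<n}" "\<And>v. v < n \<Longrightarrow> degree E v = \<Delta>"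
  shows "E \<in> regular_graphs n \<Delta>"
proof -
  have "e \<in> {{u, v} | u v. u < n \<and> v < n \<and> u \<noteq> v}" if "e \<in> E" for e
  proof -
    have "card e = 2" "e \<subseteq> {..<n}" using assms(1,2) \<open>e \<in> E\<close> by (auto dest: simple_edges_card)
    then show ?thesis by (auto simp: card_2_iff)
  qed
  then show ?thesis using assms(3) by (auto simp: regular_graphs_def)
qed

lemma finite_regular_graphs: "finite (regular_graphs n \<Delta>)"
proof (rule finite_subset)
  show "regular_graphs n \<Delta> \<subseteq> Pow (Pow {..<n})" using regular_graphs_edge_subset by blast
qed simp

lemma regular_graphs_degree_le: "E \<in> regular_graphs n \<Delta> \<Longrightarrow> degree E v \<le> \<Delta>"
proof (cases "v < n")
  case False
  assume E: "E \<in> regular_graphs n \<Delta>"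
  have "{u. {u, v} \<in> E} = {}" using regular_graphs_edge_subset[OF E] False by fastforce
  then show ?thesis by (simp add: degree_def)
qed (simp add: regular_graphs_degree)

lemma degree_subset_le:
  assumes "simple_edges E" "M \<subseteq> E"
  shows "degree M v \<le> degree E v"
  unfolding degree_def using assms finite_nbrs by (intro card_mono) auto

subsection \<open>The weight of the bottleneck\<close>

text \<open>Superadditivity of \<open>x \<mapsto> lam ^ x - 1\<close>, which for two terms is
  \<open>(a - 1) * (b - 1) \<ge> 0\<close> with \<open>a, b \<ge> 1\<close>.\<close>

lemma sum_power_minus_one_le:
  fixes lam :: real
  assumes "lam \<ge> 1" "finite C"
  shows "(\<Sum>c\<in>C. lam ^ f c - 1) \<le> lam ^ (\<Sum>c\<in>C. f c) - 1"
  using assms(2)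
proof induction
  case (insert c C)
  have "0 \<le> (lam ^ f c - 1) * (lam ^ (\<Sum>c\<in>C. f c) - 1)"
    using assms(1) by (intro mult_nonneg_nonneg) auto
  then show ?case using insert by (simp add: power_add algebra_simps)
qed simp

text \<open>Colouring one new vertex whose coloured neighbours form \<open>A\<close>: the worst case
  puts all of \<open>A\<close> in a single colour, and every other colour then contributes
  1.\<close>

lemma sum_power_count_le:
  fixes lam :: real
  assumes "lam \<ge> 1" "finite C" "finite A"
  shows "(\<Sum>c\<in>C. lam ^ card {u \<in> A. f u = c}) \<le> real (card C) - 1 + lam ^ card A"
proof -
  have "(\<Sum>c\<in>C. card {u \<in> A. f u = c}) = card (\<Union>c\<in>C. {u \<in> A. f u = c})"
    using assms by (intro card_UN_disjoint[symmetric]) auto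
  also have "\<dots> \<le> card A" using assms by (intro card_mono) auto
  finally have "lam ^ (\<Sum>c\<in>C. card {u \<in> A. f u = c}) \<le> lam ^ card A"
    using assms by (intro power_increasing) auto
  then show ?thesis
    using sum_power_minus_one_le[OF assms(1,2), of "\<lambda>c. card {u \<in> A. f u = c}"]
    by (simp add: sum_subtractf)
qed

text \<open>Both \<open>Q\<close> and \<open>lam ^ d\<close> are at most
  \<open>Q powr (1 - d / D) * lam ^ d\<close>: the first because
  \<open>Q powr (d / D) \<le> lam ^ d\<close>, the second because \<open>Q \<ge> 1\<close>. The
  exponents of this bound are affine in \<open>d\<close>, so a product of such bounds depends only
  on the number of factors and the sum of the \<open>d\<close>.\<close>

lemma add_power_le_interpolate:
  fixes lam Q :: real
  assumes "lam \<ge> 1" "Q \<ge> 1" "Q \<le> lam ^ D" "d \<le> D" "D > 0"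
  shows "Q - 1 + lam ^ d \<le> 2 * Q powr (1 - d / D) * lam ^ d"
proof -
  have "Q powr (d / D) \<le> (lam ^ D) powr (d / D)" using assms by (intro powr_mono2) auto
  also have "\<dots> = lam ^ d" using assms by (simp add: powr_powr flip: powr_realpow)
  finally have *: "Q powr (d / D) \<le> lam ^ d" .
  have "Q = Q powr (1 - d / D) * Q powr (d / D)" using assms by (simp flip: powr_add)
  also have "\<dots> \<le> Q powr (1 - d / D) * lam ^ d" using * by (intro mult_left_mono) auto
  finally have 1: "Q \<le> Q powr (1 - d / D) * lam ^ d" .
  have "1 \<le> Q powr (1 - d / D)" using assms by (intro ge_one_powr_ge_zero) auto
  then have "1 * lam ^ d \<le> Q powr (1 - d / D) * lam ^ d" using assms by (intro mult_right_mono) auto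
  with 1 show ?thesis by simp
qed

lemma inner_edges_insert_eq:
  assumes "simple_edges E" "v \<notin> U"
  shows "inner_edges E (insert v U) = inner_edges E U \<union> (\<lambda>u. {u, v}) ` {u \<in> U. {u, v} \<in> E}"
proof (intro subset_antisym subsetI)
  fix e assume e: "e \<in> inner_edges E (insert v U)"
  then have "card e = 2" using assms by (auto simp: inner_edges_def dest: simple_edges_card)
  then obtain a b where "e = {a, b}" "a \<noteq> b" by (auto simp: card_2_iff)
  then show "e \<in> inner_edges E U \<union> (\<lambda>u. {u, v}) ` {u \<in> U. {u, v} \<in> E}"
    using e by (auto simp: inner_edges_def insert_commute)
qed (auto simp: inner_edges_def)

lemma card_inner_edges_insert_filter:
  assumes "simple_edges E" "finite U" "v \<notin> U"
  shows "card {e \<in> inner_edges E (insert v U). P e} =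
    card {e \<in> inner_edges E U. P e} + card {u \<in> U. {u, v} \<in> E \<and> P {u, v}}"
proof -
  have inj: "inj_on (\<lambda>u. {u, v}) {u \<in> U. {u, v} \<in> E \<and> P {u, v}}"
    by (rule inj_onI) (auto simp: doubleton_eq_iff)
  have "{e \<in> inner_edges E (insert v U). P e} =
      {e \<in> inner_edges E U. P e} \<union> (\<lambda>u. {u, v}) ` {u \<in> U. {u, v} \<in> E \<and> P {u, v}}"
    using inner_edges_insert_eq[OF assms(1,3)] by auto
  moreover have "{e \<in> inner_edges E U. P e} \<inter> (\<lambda>u. {u, v}) ` {u \<in> U. {u, v} \<in> E \<and> P {u, v}} = {}"
    using assms(3) by (auto simp: inner_edges_def)
  ultimately show ?thesis
    using assms finite_inner_edges by (simp add: card_Un_disjoint card_image[OF inj])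
qed

text \<open>Vertices are coloured in the order of insertion. A vertex with \<open>d\<close> earlier
  neighbours costs a factor \<open>2 * Q powr (1 - d / D) * lam ^ d\<close>, and the back-degrees
  \<open>d\<close> add up to the number of inner edges whatever the order.\<close>

lemma coloring_sum_le:
  fixes lam :: real
  assumes E: "simple_edges E" and deg: "\<And>v. degree E v \<le> D" and D: "D > 0"
    and lam: "lam \<ge> 1" and C: "finite C" "card C \<ge> 1" "real (card C) \<le> lam ^ D"
    and U: "finite U"
  shows "(\<Sum>\<sigma>\<in>PiE U (\<lambda>_. C). lam ^ card {e \<in> inner_edges E U. \<exists>c. \<forall>v\<in>e. \<sigma> v = c})
    \<le> 2 ^ card U * real (card C) powr (card U - card (inner_edges E U) / D) * lam ^ card (inner_edges E U)"
  using U
proof induction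
  case empty
  have "inner_edges E {} = {}" using simple_edges_card[OF E] by (fastforce simp: inner_edges_def)
  then show ?case using C by auto
next
  case (insert v U)
  let ?Q = "real (card C)"
  let ?mono = "\<lambda>U \<sigma>. {e \<in> inner_edges E U. \<exists>c. \<forall>v\<in>e. \<sigma> v = c}"
  define d where "d = card {u \<in> U. {u, v} \<in> E}"
  have "d \<le> degree E v"
    unfolding d_def degree_def using finite_nbrs[OF E] by (intro card_mono) auto
  then have dD: "d \<le> D" using deg le_trans by blast
  have card_inner: "card (inner_edges E (insert v U)) = card (inner_edges E U) + d"
    using card_inner_edges_insert_filter[OF E insert(1,2), of "\<lambda>_. True"] by (simp add: d_def)
  \<comment> \<open>The edges gained with \<open>v\<close> are monochromatic exactly towards the
    earlier neighbours of colour \<open>c\<close>; all other inner edges keep their status.\<close>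
  have mono: "card (?mono (insert v U) (g(v := c))) =
      card (?mono U g) + card {u \<in> {u \<in> U. {u, v} \<in> E}. g u = c}" for g c
  proof -
    have "(\<forall>w\<in>e. (g(v := c)) w = a) \<longleftrightarrow> (\<forall>w\<in>e. g w = a)" if "e \<in> inner_edges E U" for e a
      using insert(2) that by (intro ball_cong refl) (auto simp: inner_edges_def)
    then have "?mono U (g(v := c)) = ?mono U g" by (intro Collect_cong) blast
    moreover have "{u \<in> U. {u, v} \<in> E \<and> (\<exists>a. \<forall>w\<in>{u, v}. (g(v := c)) w = a)} =
        {u \<in> {u \<in> U. {u, v} \<in> E}. g u = c}" using insert(2) by auto
    ultimately show ?thesis
      using card_inner_edges_insert_filter[OF E insert(1,2), of "\<lambda>e. \<exists>a. \<forall>w\<in>e. (g(v := c)) w = a"]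
      by simp
  qed
  have "(\<Sum>\<sigma>\<in>PiE (insert v U) (\<lambda>_. C). lam ^ card (?mono (insert v U) \<sigma>)) =
      (\<Sum>(c, g)\<in>C \<times> PiE U (\<lambda>_. C). lam ^ card (?mono (insert v U) (g(v := c))))"
    unfolding PiE_insert_eq using inj_combinator[OF insert(2), of "\<lambda>_. C"]
    by (subst sum.reindex) (auto simp: case_prod_unfold)
  also have "\<dots> = (\<Sum>g\<in>PiE U (\<lambda>_. C). \<Sum>c\<in>C. lam ^ card (?mono (insert v U) (g(v := c))))"
    by (subst sum.swap) (simp add: sum.cartesian_product)
  also have "\<dots> = (\<Sum>g\<in>PiE U (\<lambda>_. C). lam ^ card (?mono U g) *
      (\<Sum>c\<in>C. lam ^ card {u \<in> {u \<in> U. {u, v} \<in> E}. g u = c}))"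
    unfolding mono by (simp add: power_add sum_distrib_left)
  also have "\<dots> \<le> (\<Sum>g\<in>PiE U (\<lambda>_. C). lam ^ card (?mono U g) *
      (2 * ?Q powr (1 - d / D) * lam ^ d))"
  proof (intro sum_mono mult_left_mono)
    fix g
    have "(\<Sum>c\<in>C. lam ^ card {u \<in> {u \<in> U. {u, v} \<in> E}. g u = c}) \<le> ?Q - 1 + lam ^ d"
      unfolding d_def using insert(1) C lam by (intro sum_power_count_le) auto
    also have "\<dots> \<le> 2 * ?Q powr (1 - d / D) * lam ^ d"
      using lam C D dD by (intro add_power_le_interpolate) auto
    finally show "(\<Sum>c\<in>C. lam ^ card {u \<in> {u \<in> U. {u, v} \<in> E}. g u = c})
      \<le> 2 * ?Q powr (1 - d / D) * lam ^ d" .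
  qed (use lam in auto)
  also have "\<dots> = (\<Sum>g\<in>PiE U (\<lambda>_. C). lam ^ card (?mono U g)) * (2 * ?Q powr (1 - d / D) * lam ^ d)"
    by (rule sum_distrib_right[symmetric])
  also have "\<dots> \<le> (2 ^ card U * ?Q powr (card U - card (inner_edges E U) / D) * lam ^ card (inner_edges E U))
      * (2 * ?Q powr (1 - d / D) * lam ^ d)"
    using insert.IH lam by (intro mult_right_mono) auto
  also have "\<dots> = 2 ^ card (insert v U) *
      (?Q powr (card U - card (inner_edges E U) / D) * ?Q powr (1 - d / D)) *
      lam ^ card (inner_edges E (insert v U))"
    using insert(1,2) by (simp add: card_inner power_add)
  also have "?Q powr (card U - card (inner_edges E U) / D) * ?Q powr (1 - d / D) =
      ?Q powr (card (insert v U) - card (inner_edges E (insert v U)) / D)"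
    using insert(1,2) by (simp add: card_inner add_divide_distrib algebra_simps flip: powr_add)
  finally show ?case .
qed

text \<open>A monochromatic edge of colour 0 avoids \<open>U\<close> and one of any other colour
  lies inside \<open>U\<close>, so the edges between \<open>U\<close> and its complement are lost.
  The edges avoiding \<open>U\<close> are counted by \<open>inner_edges_complement\<close>.\<close>

lemma mono_edges_le_split:
  assumes E: "E \<in> regular_graphs n \<Delta>" and U: "U = {v. v < n \<and> \<sigma> v \<noteq> 0}"
  shows "mono_edges E \<sigma> + \<Delta> * card U \<le> card E + card (inner_edges E U) +
     card {e \<in> inner_edges E U. \<exists>c. \<forall>v\<in>e. restrict \<sigma> U v = c}"
proof -
  note s = regular_graphs_simple[OF E]
  have "{e \<in> E. \<exists>c. \<forall>v\<in>e. \<sigma> v = c} \<subseteq> inner_edges E ({..<n} - U) \<union>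
      {e \<in> inner_edges E U. \<exists>c. \<forall>v\<in>e. restrict \<sigma> U v = c}"
  proof
    fix e assume "e \<in> {e \<in> E. \<exists>c. \<forall>v\<in>e. \<sigma> v = c}"
    then obtain c where c: "e \<in> E" "\<And>v. v \<in> e \<Longrightarrow> \<sigma> v = c" by auto
    have sub: "e \<subseteq> {..<n}" using regular_graphs_edge_subset[OF E c(1)] .
    show "e \<in> inner_edges E ({..<n} - U) \<union>
      {e \<in> inner_edges E U. \<exists>c. \<forall>v\<in>e. restrict \<sigma> U v = c}"
    proof (cases "c = 0")
      case True
      then have "e \<in> inner_edges E ({..<n} - U)" using c sub by (auto simp: inner_edges_def U)
      then show ?thesis by simp
    next
      case False
      then have "e \<subseteq> U" using c sub by (auto simp: U)
      then have "e \<in> inner_edges E U" "\<forall>v\<in>e. restrict \<sigma> U v = c"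
        using c by (auto simp: inner_edges_def)
      then show ?thesis by blast
    qed
  qed
  then have "mono_edges E \<sigma> \<le> card (inner_edges E ({..<n} - U)) +
      card {e \<in> inner_edges E U. \<exists>c. \<forall>v\<in>e. restrict \<sigma> U v = c}"
    unfolding mono_edges_def
    by (intro order.trans[OF card_mono card_Un_le]) (use s finite_inner_edges in auto)
  moreover have "(\<Sum>v\<in>U. degree E v) = \<Delta> * card U"
    using regular_graphs_degree[OF E] by (simp add: U)
  moreover have "card (inner_edges E ({..<n} - U)) + (\<Sum>v\<in>U. degree E v) =
      card E + card (inner_edges E U)"
    using regular_graphs_edge_subset[OF E] by (intro inner_edges_complement s) (auto simp: U)
  ultimately show ?thesis by linarith
qed

lemma finite_configs: "finite (configs n q)"
  by (simp add: configs_def finite_PiE)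

text \<open>The factor \<open>lam ^ e(U)\<close> enters twice: once from the count of edges avoiding
  \<open>U\<close>, in which the inner edges of \<open>U\<close> were subtracted twice in the degree
  sum, and once from the colouring bound on \<open>U\<close>. The palette on \<open>U\<close> is
  \<open>{1..<q}\<close>, of size \<open>q - 1\<close>.\<close>

lemma bottleneck_fibre_le:
  fixes lam :: real
  assumes E: "E \<in> regular_graphs n \<Delta>" and "\<Delta> > 0" and lam: "lam \<ge> 1"
    and q: "q \<ge> 2" "real q - 1 \<le> lam ^ \<Delta>" and U: "U \<subseteq> {..<n}"
  shows "(\<Sum>\<sigma>\<in>{\<sigma> \<in> configs n q. {v. v < n \<and> \<sigma> v \<noteq> 0} = U}. lam ^ mono_edges E \<sigma>)
    \<le> lam ^ card E * (2 ^ card U * (real q - 1) powr (card U - card (inner_edges E U) / \<Delta>)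
        * lam powr (2 * real (card (inner_edges E U)) - real \<Delta> * card U))"
proof -
  let ?F = "{\<sigma> \<in> configs n q. {v. v < n \<and> \<sigma> v \<noteq> 0} = U}"
  let ?C = "{1..<q}"
  let ?m = "\<lambda>\<sigma>. card {e \<in> inner_edges E U. \<exists>c. \<forall>v\<in>e. \<sigma> v = c}"
  let ?e = "card (inner_edges E U)"
  let ?A = "lam ^ (card E + ?e) / lam ^ (\<Delta> * card U)"
  have fU: "finite U" using U finite_subset by blast
  \<comment> \<open>The value is 0 on the vertices off \<open>U\<close> and \<open>undefined\<close>
    beyond \<open>n\<close>, so the restriction to \<open>U\<close> determines the
    configuration.\<close>
  have inj: "inj_on (\<lambda>\<sigma>. restrict \<sigma> U) ?F"
  proof (rule inj_onI, rule ext)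
    fix \<sigma> \<tau> v assume st: "\<sigma> \<in> ?F" "\<tau> \<in> ?F" "restrict \<sigma> U = restrict \<tau> U"
    show "\<sigma> v = \<tau> v"
    proof (cases "v < n")
      case True
      have "restrict \<sigma> U v = restrict \<tau> U v" using st by simp
      moreover have "\<sigma> v = 0 \<and> \<tau> v = 0" if "v \<notin> U" using st(1,2) True that by blast
      ultimately show ?thesis by (cases "v \<in> U") auto
    next
      case False
      then show ?thesis using st by (auto simp: configs_def PiE_def extensional_def)
    qed
  qed
  have "(\<Sum>\<sigma>\<in>?F. lam ^ mono_edges E \<sigma>) \<le> (\<Sum>\<sigma>\<in>?F. ?A * lam ^ ?m (restrict \<sigma> U))"
  proof (rule sum_mono)
    fix \<sigma> assume "\<sigma> \<in> ?F"
    then have "mono_edges E \<sigma> + \<Delta> * card U \<le> card E + ?e + ?m (restrict \<sigma> U)"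
      by (intro mono_edges_le_split[OF E]) auto
    then have "lam ^ (mono_edges E \<sigma> + \<Delta> * card U) \<le> lam ^ (card E + ?e + ?m (restrict \<sigma> U))"
      using lam by (intro power_increasing) auto
    then show "lam ^ mono_edges E \<sigma> \<le> ?A * lam ^ ?m (restrict \<sigma> U)"
      using lam by (simp add: power_add field_simps)
  qed
  also have "\<dots> = ?A * (\<Sum>\<sigma>\<in>(\<lambda>\<sigma>. restrict \<sigma> U) ` ?F. lam ^ ?m \<sigma>)"
    unfolding sum.reindex[OF inj] o_def sum_distrib_left ..
  also have "\<dots> \<le> ?A * (\<Sum>\<sigma>\<in>PiE U (\<lambda>_. ?C). lam ^ ?m \<sigma>)"
  proof (intro mult_left_mono sum_mono2)
    show "(\<lambda>\<sigma>. restrict \<sigma> U) ` ?F \<subseteq> PiE U (\<lambda>_. ?C)"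
      using U by (fastforce simp: configs_def PiE_iff)
  qed (use lam in \<open>auto intro!: finite_PiE fU\<close>)
  also have "\<dots> \<le> ?A * (2 ^ card U * real (card ?C) powr (card U - ?e / \<Delta>) * lam ^ ?e)"
    using assms regular_graphs_simple[OF E] regular_graphs_degree_le[OF E] fU
    by (intro mult_left_mono coloring_sum_le) (auto simp: of_nat_diff)
  also have "real (card ?C) = real q - 1" using q by (simp add: of_nat_diff)
  also have "?A * (2 ^ card U * (real q - 1) powr (card U - ?e / \<Delta>) * lam ^ ?e) =
      lam ^ card E * (2 ^ card U * (real q - 1) powr (card U - ?e / \<Delta>)
        * (lam ^ ?e * lam ^ ?e / lam ^ (\<Delta> * card U)))"
    by (simp add: power_add field_simps)
  also have "lam ^ ?e * lam ^ ?e / lam ^ (\<Delta> * card U) = lam powr (2 * real ?e - real \<Delta> * card U)"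
  proof -
    have "lam > 0" using lam by simp
    moreover
    have "lam powr (2 * real ?e - real \<Delta> * card U) = lam powr real (?e + ?e) / lam powr real (\<Delta> * card U)"
      by (simp flip: powr_diff)
    ultimately show ?thesis by (simp only: powr_realpow power_add)
  qed
  finally show ?thesis .
qed


text \<open>After taking logarithms the exponent is affine in \<open>e\<close> with slope
  \<open>2 * l - r / D\<close>, which is nonnegative because \<open>r \<le> D * l\<close>. The worst
  case is therefore \<open>e = \<kappa> * k\<close>, and there the hypothesis on \<open>Q\<close> is
  exactly strong enough.\<close>

lemma bottleneck_exponent_le:
  fixes \<kappa> lam Q K D k e :: real
  assumes "0 < \<kappa>" "\<kappa> \<le> D / 2" "lam \<ge> 1" "Q \<ge> 1" "0 < K" "K \<le> 1" "Q \<le> lam powr D"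
    and Q: "Q \<le> K\<^sup>2 * lam powr (D - \<kappa> - \<kappa>\<^sup>2 / (D - \<kappa>))"
    and e: "0 \<le> k" "e \<le> \<kappa> * k"
  shows "Q powr (k - e / D) * lam powr (2 * e - D * k) \<le> K powr k"
proof -
  define l where "l = ln lam"
  define r where "r = ln Q"
  define s where "s = ln K"
  define x where "x = D - \<kappa> - \<kappa>\<^sup>2 / (D - \<kappa>)"
  have D: "D > 0" "D - \<kappa> > 0" using assms by auto
  have l: "l \<ge> 0" using assms by (simp add: l_def)
  have s: "s \<le> 0" using assms by (simp add: s_def)
  have "ln Q \<le> ln (lam powr D)" using assms by (subst ln_le_cancel_iff) auto
  then have r1: "r \<le> D * l" using assms by (simp add: r_def l_def)
  have "ln Q \<le> ln (K\<^sup>2 * lam powr x)" using assms unfolding x_def by (subst ln_le_cancel_iff) auto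
  also have "\<dots> = 2 * s + x * l"
    using assms by (simp add: ln_mult ln_powr s_def l_def flip: powr_numeral)
  finally have r2: "r \<le> 2 * s + x * l" by (simp add: r_def)
  \<comment> \<open>The unusual exponent equals
    \<open>D * (D - 2 * \<kappa>) / (D - \<kappa>)\<close>; it is chosen to make this product
    simple.\<close>
  have x: "(1 - \<kappa> / D) * x = D - 2 * \<kappa>"
    using D by (simp add: x_def field_simps power2_eq_square)
  have "\<kappa> / D \<le> 1 / 2" using assms D by (simp add: field_simps)
  then have half: "1 - \<kappa> / D \<ge> 1 / 2" by simp
  have "(1 - \<kappa> / D) * r \<le> (1 - \<kappa> / D) * (2 * s + x * l)"
    using half by (intro mult_left_mono r2) linarith
  also have "\<dots> = (1 - \<kappa> / D) * 2 * s + (1 - \<kappa> / D) * x * l" by (simp add: algebra_simps)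
  \<comment> \<open>The square on \<open>K\<close> pays for the factor
    \<open>1 - \<kappa> / D\<close>, which may be as small as 1/2; \<open>s\<close> is not
    positive.\<close>
  also have "(1 - \<kappa> / D) * 2 * s \<le> 1 * s"
    using half s by (intro mult_right_mono_neg) auto
  finally have main: "(1 - \<kappa> / D) * r \<le> s + (D - 2 * \<kappa>) * l" using x by simp
  have "r / D \<le> l" using r1 D by (simp add: field_simps)
  then have nn: "0 \<le> 2 * l - r / D" using l by simp
  have "(k - e / D) * r + (2 * e - D * k) * l = k * (r - D * l) + e * (2 * l - r / D)"
    by (simp add: algebra_simps)
  also have "\<dots> \<le> k * (r - D * l) + \<kappa> * k * (2 * l - r / D)"
    using e nn by (intro add_left_mono mult_right_mono) auto
  also have "\<dots> = k * ((1 - \<kappa> / D) * r - (D - 2 * \<kappa>) * l)" by (simp add: algebra_simps)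
  also have "\<dots> \<le> k * s" using main e by (intro mult_left_mono) auto
  finally have "exp ((k - e / D) * r + (2 * e - D * k) * l) \<le> exp (k * s)" by simp
  then show ?thesis using assms by (simp add: powr_def exp_add l_def r_def s_def)
qed

lemma bottleneck_weight_le:
  fixes lam \<kappa> b :: real
  assumes E: "E \<in> regular_graphs n \<Delta>" and lam: "lam \<ge> 1"
    and \<kappa>: "0 < \<kappa>" "\<kappa> \<le> real \<Delta> / 2" and b: "0 < b" "b \<le> 1" and q: "q \<ge> 2"
    and Q: "real q - 1 \<le> b\<^sup>2 / (256 * (exp 1)\<^sup>2) * lam powr (real \<Delta> - \<kappa> - \<kappa>\<^sup>2 / (real \<Delta> - \<kappa>))"
    and sparse: "\<And>U. U \<subseteq> {..<n} \<Longrightarrow> card U = k \<Longrightarrow> real (card (inner_edges E U)) \<le> \<kappa> * real k"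
  shows "(\<Sum>\<sigma>\<in>{\<sigma> \<in> configs n q. card {v. v < n \<and> \<sigma> v \<noteq> 0} = k}. lam ^ mono_edges E \<sigma>)
    \<le> lam ^ card E * (real (n choose k) * (b / (8 * exp 1)) ^ k)"
proof -
  \<comment> \<open>\<open>K\<^sup>2\<close> is the constant in the bound on \<open>q\<close>. The
    colouring bound loses \<open>2 ^ k\<close>, which turns \<open>K ^ k\<close> into
    \<open>(b / (8 * exp 1)) ^ k\<close>.\<close>
  define K where "K = b / (16 * exp 1)"
  let ?Q = "real q - 1"
  let ?\<U> = "{U. U \<subseteq> {..<n} \<and> card U = k}"
  let ?F = "\<lambda>U. {\<sigma> \<in> configs n q. {v. v < n \<and> \<sigma> v \<noteq> 0} = U}"
  have D: "real \<Delta> > 0" "real \<Delta> - \<kappa> > 0" using \<kappa> by auto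
  have e1: "exp 1 \<ge> (1::real)" by simp
  have "b \<le> 16 * exp 1" using b e1 by linarith
  then have K: "0 < K" "K \<le> 1" using b by (auto simp: K_def)
  have K2: "b\<^sup>2 / (256 * (exp 1)\<^sup>2) = K\<^sup>2" by (simp add: K_def power_divide power_mult_distrib)
  \<comment> \<open>This yields \<open>q - 1 \<le> lam ^ \<Delta>\<close>, the condition under which
    the interpolation of the colouring bound is valid.\<close>
  have "lam powr (real \<Delta> - \<kappa> - \<kappa>\<^sup>2 / (real \<Delta> - \<kappa>)) \<le> lam powr real \<Delta>"
    using lam \<kappa> D by (intro powr_mono) (auto intro: order.trans[of _ "0::real"])
  moreover have "K\<^sup>2 \<le> 1" using K by (simp add: power_le_one)
  ultimately have "K\<^sup>2 * lam powr (real \<Delta> - \<kappa> - \<kappa>\<^sup>2 / (real \<Delta> - \<kappa>)) \<le> 1 * lam powr real \<Delta>"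
    by (intro mult_mono) auto
  then have QD: "?Q \<le> lam powr real \<Delta>" using Q K2 by simp
  have fibre: "(\<Sum>\<sigma>\<in>?F U. lam ^ mono_edges E \<sigma>) \<le> lam ^ card E * (b / (8 * exp 1)) ^ k"
    if U: "U \<in> ?\<U>" for U
  proof -
    let ?e = "real (card (inner_edges E U))"
    have "?Q powr (real k - ?e / \<Delta>) * lam powr (2 * ?e - real \<Delta> * k) \<le> K powr k"
      using \<kappa> lam q K QD Q K2 sparse U by (intro bottleneck_exponent_le[where \<kappa> = \<kappa>]) auto
    also have "\<dots> = K ^ k" using K by (simp add: powr_realpow)
    finally have "2 ^ k * (?Q powr (real k - ?e / \<Delta>) * lam powr (2 * ?e - real \<Delta> * k)) \<le> 2 ^ k * K ^ k"
      by simp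
    also have "\<dots> = (b / (8 * exp 1)) ^ k" by (simp add: K_def flip: power_mult_distrib)
    finally have le: "2 ^ k * (?Q powr (real k - ?e / \<Delta>) * lam powr (2 * ?e - real \<Delta> * k)) \<le> (b / (8 * exp 1)) ^ k" .
    have "(\<Sum>\<sigma>\<in>?F U. lam ^ mono_edges E \<sigma>) \<le>
        lam ^ card E * (2 ^ k * ?Q powr (k - ?e / \<Delta>) * lam powr (2 * ?e - real \<Delta> * k))"
      using bottleneck_fibre_le[OF E _ lam q _, of U] U D QD lam by (auto simp: powr_realpow)
    also have "\<dots> \<le> lam ^ card E * (b / (8 * exp 1)) ^ k"
      using lam le by (intro mult_left_mono) (auto simp: mult.assoc)
    finally show ?thesis .
  qed
  have "{\<sigma> \<in> configs n q. card {v. v < n \<and> \<sigma> v \<noteq> 0} = k} = (\<Union>U\<in>?\<U>. ?F U)" by auto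
  then have "(\<Sum>\<sigma>\<in>{\<sigma> \<in> configs n q. card {v. v < n \<and> \<sigma> v \<noteq> 0} = k}. lam ^ mono_edges E \<sigma>) =
      (\<Sum>U\<in>?\<U>. \<Sum>\<sigma>\<in>?F U. lam ^ mono_edges E \<sigma>)"
    using finite_configs by (simp only:) (subst sum.UNION_disjoint, auto)
  also have "\<dots> \<le> (\<Sum>U\<in>?\<U>. lam ^ card E * (b / (8 * exp 1)) ^ k)"
    using fibre by (intro sum_mono) auto
  also have "\<dots> = lam ^ card E * (real (n choose k) * (b / (8 * exp 1)) ^ k)"
    using n_subsets[of "{..<n}" k] by simp
  finally show ?thesis .
qed

subsection \<open>Slow mixing across a bottleneck\<close>

text \<open>The t-step kernel is a parameter tied to \<open>P\<close> by its recurrence, so that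
  \<open>glauber_Pt\<close> is an instance as it stands. Row sums and stationarity are required on
  \<open>\<Omega>\<close> only.\<close>

locale finite_chain =
  fixes \<Omega> :: "'a set" and P :: "'a \<Rightarrow> 'a \<Rightarrow> real" and Pt :: "nat \<Rightarrow> 'a \<Rightarrow> 'a \<Rightarrow> real"
    and \<pi> :: "'a \<Rightarrow> real"
  assumes finite_states: "finite \<Omega>"
    and P_nonneg: "\<And>X Y. P X Y \<ge> 0"
    and P_sum: "\<And>X. X \<in> \<Omega> \<Longrightarrow> (\<Sum>Y\<in>\<Omega>. P X Y) = 1"
    and Pt_0: "\<And>X Y. Pt 0 X Y = (if X = Y then 1 else 0)"
    and Pt_Suc: "\<And>t X Y. Pt (Suc t) X Y = (\<Sum>Z\<in>\<Omega>. Pt t X Z * P Z Y)"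
    and pi_nonneg: "\<And>X. \<pi> X \<ge> 0"
    and pi_sum: "(\<Sum>X\<in>\<Omega>. \<pi> X) = 1"
    and stationary: "\<And>Y. Y \<in> \<Omega> \<Longrightarrow> (\<Sum>X\<in>\<Omega>. \<pi> X * P X Y) = \<pi> Y"
begin

lemma Pt_nonneg: "Pt t X Y \<ge> 0"
  by (induction t arbitrary: Y) (auto simp: Pt_0 Pt_Suc P_nonneg intro!: sum_nonneg)

lemma Pt_sum: "X \<in> \<Omega> \<Longrightarrow> (\<Sum>Y\<in>\<Omega>. Pt t X Y) = 1"
proof (induction t)
  case 0
  then show ?case using finite_states by (simp add: Pt_0)
next
  case (Suc t)
  have "(\<Sum>Y\<in>\<Omega>. Pt (Suc t) X Y) = (\<Sum>Z\<in>\<Omega>. Pt t X Z * (\<Sum>Y\<in>\<Omega>. P Z Y))"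
    unfolding Pt_Suc sum_distrib_left by (rule sum.swap)
  also have "\<dots> = (\<Sum>Z\<in>\<Omega>. Pt t X Z)" using P_sum by simp
  finally show ?case using Suc by simp
qed

text \<open>Since \<open>\<pi>\<close> is stationary, the signed difference to \<open>\<pi>\<close>
  is itself pushed forward by \<open>P\<close>, and a kernel with nonnegative rows of sum 1 does not
  increase the l1 norm.\<close>

lemma l1_dist_Suc_le:
  "(\<Sum>Y\<in>\<Omega>. \<bar>Pt (Suc t) X Y - \<pi> Y\<bar>) \<le> (\<Sum>Y\<in>\<Omega>. \<bar>Pt t X Y - \<pi> Y\<bar>)"
proof -
  have "(\<Sum>Y\<in>\<Omega>. \<bar>Pt (Suc t) X Y - \<pi> Y\<bar>) = (\<Sum>Y\<in>\<Omega>. \<bar>\<Sum>Z\<in>\<Omega>. (Pt t X Z - \<pi> Z) * P Z Y\<bar>)"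
    by (intro sum.cong refl) (simp add: Pt_Suc left_diff_distrib sum_subtractf stationary)
  also have "\<dots> \<le> (\<Sum>Y\<in>\<Omega>. \<Sum>Z\<in>\<Omega>. \<bar>Pt t X Z - \<pi> Z\<bar> * P Z Y)"
    by (intro sum_mono order.trans[OF sum_abs]) (simp add: abs_mult P_nonneg)
  also have "\<dots> = (\<Sum>Z\<in>\<Omega>. \<bar>Pt t X Z - \<pi> Z\<bar> * (\<Sum>Y\<in>\<Omega>. P Z Y))"
    unfolding sum_distrib_left by (rule sum.swap)
  also have "\<dots> = (\<Sum>Z\<in>\<Omega>. \<bar>Pt t X Z - \<pi> Z\<bar>)" using P_sum by simp
  finally show ?thesis .
qed

lemma l1_dist_antimono:
  "s \<le> t \<Longrightarrow> (\<Sum>Y\<in>\<Omega>. \<bar>Pt t X Y - \<pi> Y\<bar>) \<le> (\<Sum>Y\<in>\<Omega>. \<bar>Pt s X Y - \<pi> Y\<bar>)"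
  by (induction rule: dec_induct) (auto intro: order.trans[OF l1_dist_Suc_le])

text \<open>Started from \<open>\<pi>\<close> restricted to \<open>S\<close>, the chain stays
  pointwise below \<open>\<pi>\<close> at all times, as it starts below \<open>\<pi>\<close> and
  \<open>\<pi>\<close> is preserved.\<close>

lemma stationary_Pt_le:
  assumes "S \<subseteq> \<Omega>" "Y \<in> \<Omega>"
  shows "(\<Sum>X\<in>S. \<pi> X * Pt t X Y) \<le> \<pi> Y"
  using assms(2)
proof (induction t arbitrary: Y)
  case 0
  have "finite S" using assms finite_states finite_subset by blast
  then show ?case using pi_nonneg[of Y] by (auto simp: Pt_0 if_distrib cong: if_cong)
next
  case (Suc t)
  have "(\<Sum>X\<in>S. \<pi> X * Pt (Suc t) X Y) = (\<Sum>X\<in>S. \<Sum>Z\<in>\<Omega>. \<pi> X * Pt t X Z * P Z Y)"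
    by (simp add: Pt_Suc sum_distrib_left mult.assoc)
  also have "\<dots> = (\<Sum>Z\<in>\<Omega>. (\<Sum>X\<in>S. \<pi> X * Pt t X Z) * P Z Y)"
    unfolding sum_distrib_right by (rule sum.swap)
  also have "\<dots> \<le> (\<Sum>Z\<in>\<Omega>. \<pi> Z * P Z Y)"
    using Suc.IH P_nonneg by (intro sum_mono mult_right_mono) auto
  finally show ?case using stationary Suc.prems by simp
qed

text \<open>The chain starts from \<open>\<pi>\<close> restricted to \<open>S\<close>. New mass can
  leave \<open>S\<close> only from \<open>B\<close>, and by \<open>stationary_Pt_le\<close> the mass
  present on \<open>B\<close> is at most \<open>\<pi>(B)\<close> at any time, so each step adds at
  most \<open>\<pi>(B)\<close> to the mass outside.\<close>

lemma escape_le: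
  assumes S: "S \<subseteq> \<Omega>" and B: "B \<subseteq> S"
    and exit: "\<And>X Y. X \<in> S - B \<Longrightarrow> Y \<in> \<Omega> - S \<Longrightarrow> P X Y = 0"
  shows "(\<Sum>X\<in>S. \<pi> X * (\<Sum>Y\<in>\<Omega> - S. Pt t X Y)) \<le> real t * (\<Sum>X\<in>B. \<pi> X)"
proof (induction t)
  case 0
  have "(\<Sum>Y\<in>\<Omega> - S. Pt 0 X Y) = 0" if "X \<in> S" for X
    using that by (intro sum.neutral) (auto simp: Pt_0)
  then show ?case by simp
next
  case (Suc t)
  let ?f = "\<lambda>Z. \<Sum>X\<in>S. \<pi> X * Pt t X Z"
  let ?out = "\<lambda>Z. \<Sum>Y\<in>\<Omega> - S. P Z Y"
  have fS: "finite S" using S finite_states finite_subset by blast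
  have f0: "?f Z \<ge> 0" for Z using pi_nonneg Pt_nonneg by (intro sum_nonneg) auto
  have out0: "?out Z \<ge> 0" for Z using P_nonneg by (intro sum_nonneg) auto
  have out1: "?out Z \<le> 1" if "Z \<in> \<Omega>" for Z
  proof -
    have "?out Z \<le> (\<Sum>Y\<in>\<Omega>. P Z Y)"
      using P_nonneg finite_states by (intro sum_mono2) auto
    then show ?thesis using P_sum that by simp
  qed
  have "(\<Sum>X\<in>S. \<pi> X * (\<Sum>Y\<in>\<Omega> - S. Pt (Suc t) X Y)) =
      (\<Sum>X\<in>S. \<Sum>Y\<in>\<Omega> - S. \<Sum>Z\<in>\<Omega>. \<pi> X * Pt t X Z * P Z Y)"
    by (simp add: Pt_Suc sum_distrib_left mult.assoc)
  also have "\<dots> = (\<Sum>X\<in>S. \<Sum>Z\<in>\<Omega>. \<pi> X * Pt t X Z * ?out Z)"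
    unfolding sum_distrib_left by (intro sum.cong refl sum.swap)
  also have "\<dots> = (\<Sum>Z\<in>\<Omega>. ?f Z * ?out Z)"
    unfolding sum_distrib_right by (rule sum.swap)
  also have "\<dots> = (\<Sum>Z\<in>\<Omega> - S. ?f Z * ?out Z) + (\<Sum>Z\<in>S. ?f Z * ?out Z)"
    using S finite_states by (intro sum.subset_diff) auto
  \<comment> \<open>Mass already outside is counted in full, ignoring any return to
    \<open>S\<close>.\<close>
  also have "(\<Sum>Z\<in>\<Omega> - S. ?f Z * ?out Z) \<le> (\<Sum>Z\<in>\<Omega> - S. ?f Z)"
    using f0 out1 by (intro sum_mono mult_left_le) auto
  also have "(\<Sum>Z\<in>\<Omega> - S. ?f Z) = (\<Sum>X\<in>S. \<pi> X * (\<Sum>Y\<in>\<Omega> - S. Pt t X Y))"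
    unfolding sum_distrib_left by (rule sum.swap)
  also have "\<dots> \<le> real t * (\<Sum>X\<in>B. \<pi> X)" by (rule Suc.IH)
  also have "(\<Sum>Z\<in>S. ?f Z * ?out Z) = (\<Sum>Z\<in>B. ?f Z * ?out Z)"
  proof (rule sum.mono_neutral_right[OF fS B], rule ballI)
    fix Z assume "Z \<in> S - B"
    then have "?out Z = 0" using exit by (intro sum.neutral) auto
    then show "?f Z * ?out Z = 0" by simp
  qed
  also have "\<dots> \<le> (\<Sum>Z\<in>B. \<pi> Z * 1)"
    using stationary_Pt_le[OF S] S B f0 out0 out1 pi_nonneg by (intro sum_mono mult_mono) auto
  finally show ?case by (simp add: algebra_simps)
qed

text \<open>Both sides are probability distributions, so a deficit on \<open>A\<close> is matched by
  an equal surplus off \<open>A\<close>, and the l1 distance sees it twice.\<close>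

lemma mass_diff_le_tv:
  assumes "X \<in> \<Omega>" "A \<subseteq> \<Omega>"
  shows "(\<Sum>Y\<in>A. \<pi> Y) - (\<Sum>Y\<in>A. Pt t X Y) \<le> 1 / 2 * (\<Sum>Y\<in>\<Omega>. \<bar>Pt t X Y - \<pi> Y\<bar>)"
proof -
  let ?d = "\<lambda>Y. \<pi> Y - Pt t X Y"
  have split: "(\<Sum>Y\<in>\<Omega>. f Y) = (\<Sum>Y\<in>\<Omega> - A. f Y) + (\<Sum>Y\<in>A. f Y)" for f :: "'a \<Rightarrow> real"
    using assms finite_states by (intro sum.subset_diff) auto
  have "(\<Sum>Y\<in>\<Omega> - A. ?d Y) + (\<Sum>Y\<in>A. ?d Y) = 0"
    using Pt_sum[OF assms(1), of t] pi_sum unfolding split[symmetric] by (simp add: sum_subtractf)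
  then have "2 * (\<Sum>Y\<in>A. ?d Y) = (\<Sum>Y\<in>A. ?d Y) + (\<Sum>Y\<in>\<Omega> - A. - ?d Y)"
    unfolding sum_negf by linarith
  also have "\<dots> \<le> (\<Sum>Y\<in>A. \<bar>Pt t X Y - \<pi> Y\<bar>) + (\<Sum>Y\<in>\<Omega> - A. \<bar>Pt t X Y - \<pi> Y\<bar>)"
    by (intro add_mono sum_mono) auto
  also have "\<dots> = (\<Sum>Y\<in>\<Omega>. \<bar>Pt t X Y - \<pi> Y\<bar>)" by (simp add: split)
  finally show ?thesis by (simp add: sum_subtractf)
qed

text \<open>A mixed chain has put mass at least \<open>\<pi>(\<Omega> - S) - \<delta>\<close>
  outside \<open>S\<close> from every start; averaging over starts in \<open>S\<close> and comparing
  with \<open>escape_le\<close> bounds the time from below.\<close>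

lemma bottleneck_mixing:
  assumes S: "S \<subseteq> \<Omega>" and B: "B \<subseteq> S"
    and exit: "\<And>X Y. X \<in> S - B \<Longrightarrow> Y \<in> \<Omega> - S \<Longrightarrow> P X Y = 0"
    and mix: "\<And>X. X \<in> \<Omega> \<Longrightarrow> \<exists>t. real t < T \<and> 1 / 2 * (\<Sum>Y\<in>\<Omega>. \<bar>Pt t X Y - \<pi> Y\<bar>) \<le> \<delta>"
    and ne: "\<Omega> \<noteq> {}"
  shows "((\<Sum>Y\<in>\<Omega> - S. \<pi> Y) - \<delta>) * (\<Sum>X\<in>S. \<pi> X) \<le> T * (\<Sum>X\<in>B. \<pi> X)"
proof -
  from mix obtain \<tau> where \<tau>: "\<And>X. X \<in> \<Omega> \<Longrightarrow> real (\<tau> X) < T"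
    "\<And>X. X \<in> \<Omega> \<Longrightarrow> 1 / 2 * (\<Sum>Y\<in>\<Omega>. \<bar>Pt (\<tau> X) X Y - \<pi> Y\<bar>) \<le> \<delta>" by metis
  \<comment> \<open>Each start has its own time; as the distance never increases, all of them are
    still mixed at the largest one, which is below \<open>T\<close> because \<open>\<Omega>\<close>
    is finite.\<close>
  define t where "t = Max (\<tau> ` \<Omega>)"
  have "t \<in> \<tau> ` \<Omega>" unfolding t_def using ne finite_states by (intro Max_in) auto
  then have tT: "real t < T" using \<tau>(1) by auto
  have le: "\<tau> X \<le> t" if "X \<in> \<Omega>" for X unfolding t_def using that finite_states by auto
  have out: "(\<Sum>Y\<in>\<Omega> - S. \<pi> Y) - \<delta> \<le> (\<Sum>Y\<in>\<Omega> - S. Pt t X Y)" if X: "X \<in> \<Omega>" for X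
    using mass_diff_le_tv[OF X, of "\<Omega> - S" t] l1_dist_antimono[OF le[OF X], of X] \<tau>(2)[OF X] by auto
  have "((\<Sum>Y\<in>\<Omega> - S. \<pi> Y) - \<delta>) * (\<Sum>X\<in>S. \<pi> X) =
      (\<Sum>X\<in>S. \<pi> X * ((\<Sum>Y\<in>\<Omega> - S. \<pi> Y) - \<delta>))"
    by (simp only: sum_distrib_right mult.commute)
  also have "\<dots> \<le> (\<Sum>X\<in>S. \<pi> X * (\<Sum>Y\<in>\<Omega> - S. Pt t X Y))"
    using out S pi_nonneg by (intro sum_mono mult_left_mono) auto
  also have "\<dots> \<le> real t * (\<Sum>X\<in>B. \<pi> X)" by (rule escape_le[OF S B exit])
  also have "\<dots> \<le> T * (\<Sum>X\<in>B. \<pi> X)"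
    using tT pi_nonneg by (intro mult_right_mono sum_nonneg) auto
  finally show ?thesis .
qed

end

subsection \<open>The Glauber dynamics\<close>

text \<open>Only the edges at \<open>v\<close> feel the new colour, so the Gibbs weight factors into
  a part independent of \<open>a\<close> and the heat-bath weight of \<open>a\<close>.\<close>

lemma mono_edges_update:
  assumes E: "simple_edges E"
  shows "mono_edges E (Y(v := a)) =
    card {e \<in> E. v \<notin> e \<and> (\<exists>c. \<forall>w\<in>e. Y w = c)} + nbr_count E Y v a"
proof -
  let ?B = "{u. {u, v} \<in> E \<and> Y u = a}"
  have inj: "inj_on (\<lambda>u. {u, v}) ?B" by (rule inj_onI) (auto simp: doubleton_eq_iff)
  have off: "(\<forall>w\<in>e. (Y(v := a)) w = c) \<longleftrightarrow> (\<forall>w\<in>e. Y w = c)" if "v \<notin> e" for e c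
    using that by (intro ball_cong refl) auto
  have on: "(\<exists>c. \<forall>w\<in>{u, v}. (Y(v := a)) w = c) \<longleftrightarrow> Y u = a" if "{u, v} \<in> E" for u
    using that simple_edges_irrefl[OF E, of v] by auto
  have inc: "{e \<in> E. v \<in> e} = (\<lambda>u. {u, v}) ` {u. {u, v} \<in> E}"
    using bij_betw_nbrs_incident[OF E, of v] by (simp add: bij_betw_def)
  have "{e \<in> E. v \<in> e \<and> (\<exists>c. \<forall>w\<in>e. (Y(v := a)) w = c)} =
      {e \<in> (\<lambda>u. {u, v}) ` {u. {u, v} \<in> E}. \<exists>c. \<forall>w\<in>e. (Y(v := a)) w = c}"
    unfolding inc[symmetric] by blast
  also have "\<dots> = (\<lambda>u. {u, v}) ` {u. {u, v} \<in> E \<and> (\<exists>c. \<forall>w\<in>{u, v}. (Y(v := a)) w = c)}"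
    by blast
  also have "{u. {u, v} \<in> E \<and> (\<exists>c. \<forall>w\<in>{u, v}. (Y(v := a)) w = c)} = ?B"
    using on by blast
  finally have 1: "{e \<in> E. v \<in> e \<and> (\<exists>c. \<forall>w\<in>e. (Y(v := a)) w = c)} = (\<lambda>u. {u, v}) ` ?B" .
  have 2: "{e \<in> E. v \<notin> e \<and> (\<exists>c. \<forall>w\<in>e. (Y(v := a)) w = c)} =
      {e \<in> E. v \<notin> e \<and> (\<exists>c. \<forall>w\<in>e. Y w = c)}" using off by blast
  have "{e \<in> E. \<exists>c. \<forall>w\<in>e. (Y(v := a)) w = c} =
      {e \<in> E. v \<notin> e \<and> (\<exists>c. \<forall>w\<in>e. (Y(v := a)) w = c)} \<union>
      {e \<in> E. v \<in> e \<and> (\<exists>c. \<forall>w\<in>e. (Y(v := a)) w = c)}" by blast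
  then have "mono_edges E (Y(v := a)) =
      card {e \<in> E. v \<notin> e \<and> (\<exists>c. \<forall>w\<in>e. (Y(v := a)) w = c)} +
      card {e \<in> E. v \<in> e \<and> (\<exists>c. \<forall>w\<in>e. (Y(v := a)) w = c)}"
    unfolding mono_edges_def using simple_edges_finite[OF E]
    by (simp only:) (subst card_Un_disjoint, auto)
  then show ?thesis unfolding 1 2 card_image[OF inj] by (simp add: nbr_count_def)
qed

lemma nbr_count_update:
  assumes "simple_edges E"
  shows "nbr_count E (Y(v := a)) v c = nbr_count E Y v c"
proof -
  have "{u. {u, v} \<in> E \<and> (Y(v := a)) u = c} = {u. {u, v} \<in> E \<and> Y u = c}"
    using simple_edges_irrefl[OF assms, of v] by auto
  then show ?thesis by (simp add: nbr_count_def)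
qed

lemma configs_update: "X \<in> configs n q \<Longrightarrow> v < n \<Longrightarrow> c < q \<Longrightarrow> X(v := c) \<in> configs n q"
  by (auto simp: configs_def PiE_iff extensional_def)

lemma glauber_row_sum:
  assumes "n > 0" "q > 0" "lam > 0" "X \<in> configs n q"
  shows "(\<Sum>Y\<in>configs n q. glauber_P n E lam q X Y) = 1"
proof -
  let ?N = "\<lambda>v. \<Sum>c'<q. lam ^ nbr_count E X v c'"
  let ?p = "\<lambda>v c. (1 / real n) * (lam ^ nbr_count E X v c / ?N v)"
  have N: "?N v > 0" for v using assms by (intro sum_pos) auto
  have "(\<Sum>Y\<in>configs n q. glauber_P n E lam q X Y) =
      (\<Sum>v<n. \<Sum>c<q. \<Sum>Y\<in>configs n q. if X(v := c) = Y then ?p v c else 0)"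
    unfolding glauber_P_def
    by (subst sum.swap, intro sum.cong refl, rule sum.swap)
  also have "\<dots> = (\<Sum>v<n. \<Sum>c<q. ?p v c)"
    using assms(4) configs_update finite_configs by (intro sum.cong refl) simp
  also have "\<dots> = (\<Sum>v<n. 1 / real n)"
  proof (intro sum.cong refl)
    fix v
    have "(\<Sum>c<q. ?p v c) = 1 / real n * (?N v / ?N v)"
      by (simp only: sum_distrib_left sum_divide_distrib)
    then show "(\<Sum>c<q. ?p v c) = 1 / real n" using N[of v] by simp
  qed
  finally show ?thesis using assms by simp
qed

text \<open>A heat-bath update at \<open>v\<close> resamples the colour of \<open>v\<close> from its
  conditional Gibbs law. The states that can move to \<open>Y\<close> are the
  \<open>Y(v := a)\<close>; all have the same update law, and their weights add up to
  \<open>R * ?N\<close>.\<close>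

lemma glauber_vertex_stationary:
  fixes lam :: real
  assumes E: "simple_edges E" and lam: "lam > 0" and v: "v < n" and Y: "Y \<in> configs n q"
  shows "(\<Sum>X\<in>configs n q. lam ^ mono_edges E X * (\<Sum>c<q. if X(v := c) = Y then
      lam ^ nbr_count E X v c / (\<Sum>c'<q. lam ^ nbr_count E X v c') else 0)) = lam ^ mono_edges E Y"
    (is "(\<Sum>X\<in>_. ?g X) = _")
proof -
  let ?N = "\<Sum>c<q. lam ^ nbr_count E Y v c"
  let ?f = "\<lambda>a. Y(v := a)"
  define R where "R = lam ^ card {e \<in> E. v \<notin> e \<and> (\<exists>c. \<forall>w\<in>e. Y w = c)}"
  have Yv: "Y v < q" using Y v by (auto simp: configs_def PiE_iff)
  have N: "?N > 0" using lam Yv by (intro sum_pos) auto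
  have inj: "inj_on ?f {..<q}" by (rule inj_onI) (metis fun_upd_same)
  have w: "lam ^ mono_edges E (?f a) = R * lam ^ nbr_count E Y v a" for a
    by (simp add: mono_edges_update[OF E] R_def power_add)
  have "(\<Sum>X\<in>configs n q. ?g X) = (\<Sum>X\<in>?f ` {..<q}. ?g X)"
  proof (rule sum.mono_neutral_right[OF finite_configs])
    show "?f ` {..<q} \<subseteq> configs n q" using Y v configs_update by auto
    show "\<forall>X\<in>configs n q - ?f ` {..<q}. ?g X = 0"
    proof
      fix X assume X: "X \<in> configs n q - ?f ` {..<q}"
      have "X(v := c) \<noteq> Y" for c
      proof
        assume "X(v := c) = Y"
        then have "X = ?f (X v)" by auto
        moreover have "X v < q" using X v by (auto simp: configs_def PiE_iff)
        ultimately show False using X by auto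
      qed
      then show "?g X = 0" by simp
    qed
  qed
  also have "\<dots> = (\<Sum>a<q. ?g (?f a))" by (simp only: sum.reindex[OF inj] o_def)
  also have "\<dots> = (\<Sum>a<q. R * lam ^ nbr_count E Y v a * (lam ^ nbr_count E Y v (Y v) / ?N))"
  proof (intro sum.cong refl)
    fix a
    have iff: "(?f a)(v := c) = Y \<longleftrightarrow> Y v = c" for c by (auto simp: fun_eq_iff)
    show "?g (?f a) = R * lam ^ nbr_count E Y v a * (lam ^ nbr_count E Y v (Y v) / ?N)"
      unfolding w iff nbr_count_update[OF E] using Yv by simp
  qed
  also have "\<dots> = ?N * (R * lam ^ nbr_count E Y v (Y v) / ?N)"
    unfolding sum_distrib_right by (intro sum.cong refl) simp
  also have "\<dots> = lam ^ mono_edges E Y" using N w[of "Y v"] by simp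
  finally show ?thesis .
qed

lemma glauber_stationary:
  assumes "simple_edges E" "lam > 0" "n > 0" "Y \<in> configs n q"
  shows "(\<Sum>X\<in>configs n q. lam ^ mono_edges E X * glauber_P n E lam q X Y) = lam ^ mono_edges E Y"
proof -
  have "(\<Sum>X\<in>configs n q. lam ^ mono_edges E X * glauber_P n E lam q X Y) =
    (\<Sum>X\<in>configs n q. \<Sum>v<n. 1 / real n * (lam ^ mono_edges E X * (\<Sum>c<q. if X(v := c) = Y then
      lam ^ nbr_count E X v c / (\<Sum>c'<q. lam ^ nbr_count E X v c') else 0)))"
    unfolding glauber_P_def sum_distrib_left
    by (intro sum.cong refl) auto
  also have "\<dots> = (\<Sum>v<n. 1 / real n * (\<Sum>X\<in>configs n q. lam ^ mono_edges E X * (\<Sum>c<q. if X(v := c) = Y then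
      lam ^ nbr_count E X v c / (\<Sum>c'<q. lam ^ nbr_count E X v c') else 0)))"
    by (subst sum.swap) (simp only: sum_distrib_left)
  also have "\<dots> = (\<Sum>v<n. 1 / real n * lam ^ mono_edges E Y)"
    using assms glauber_vertex_stationary by (intro sum.cong refl) auto
  finally show ?thesis using assms by simp
qed

lemma configs_nonempty: "q > 0 \<Longrightarrow> configs n q \<noteq> {}"
  by (auto simp: configs_def PiE_eq_empty_iff)

lemma partition_function_pos:
  assumes "q > 0" "lam > 0"
  shows "(\<Sum>\<tau>\<in>configs n q. lam ^ mono_edges E \<tau> :: real) > 0"
  using assms finite_configs configs_nonempty by (intro sum_pos) auto

lemma glauber_finite_chain:
  assumes "simple_edges E" "lam > 0" "n > 0" "q > 0"
  shows "finite_chain (configs n q) (glauber_P n E lam q) (glauber_Pt n E lam q) (gibbs n E lam q)"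
proof
  show "(\<Sum>X\<in>configs n q. gibbs n E lam q X * glauber_P n E lam q X Y) = gibbs n E lam q Y"
    if "Y \<in> configs n q" for Y
    using glauber_stationary[OF assms(1-3) that]
    by (simp add: gibbs_def flip: sum_divide_distrib)
  show "(\<Sum>X\<in>configs n q. gibbs n E lam q X) = 1"
    using partition_function_pos[OF assms(4,2), of E n]
    by (simp add: gibbs_def flip: sum_divide_distrib)
  show "glauber_P n E lam q X Y \<ge> 0" for X Y
    unfolding glauber_P_def using assms by (intro sum_nonneg) (auto intro!: divide_nonneg_nonneg mult_nonneg_nonneg sum_nonneg)
  show "gibbs n E lam q X \<ge> 0" for X
    unfolding gibbs_def using assms by (intro divide_nonneg_nonneg sum_nonneg) auto
qed (use assms in \<open>auto simp: finite_configs glauber_row_sum\<close>)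

text \<open>Exchanging the colours 0 and 1 preserves the weight and carries \<open>S\<close>
  injectively into its complement, since for \<open>2 * k < n\<close> colour 0 cannot have a
  majority both before and after the exchange.\<close>

lemma minority_weight_le:
  fixes lam :: real
  assumes E: "E \<in> regular_graphs n \<Delta>" and lam: "lam > 0" and q: "q \<ge> 2" and k: "2 * k < n"
  defines "S \<equiv> {\<sigma> \<in> configs n q. card {v. v < n \<and> \<sigma> v \<noteq> 0} \<le> k}"
  shows "(\<Sum>\<sigma>\<in>S. lam ^ mono_edges E \<sigma>) \<le> (\<Sum>\<sigma>\<in>configs n q - S. lam ^ mono_edges E \<sigma>)"
proof -
  define s where "s = Transposition.transpose (0::nat) 1"
  \<comment> \<open>The value \<open>undefined\<close> beyond \<open>n\<close> keeps the image
    extensional, as \<open>configs\<close> demands.\<close>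
  define f where "f \<sigma> = (\<lambda>v. if v < n then s (\<sigma> v) else undefined)" for \<sigma> :: "nat \<Rightarrow> nat"
  have s_eq: "s a = s b \<longleftrightarrow> a = b" for a b unfolding s_def by (metis transpose_involutory)
  have inj: "inj_on f S"
  proof (rule inj_onI, rule ext)
    fix \<sigma> \<tau> v assume st: "\<sigma> \<in> S" "\<tau> \<in> S" "f \<sigma> = f \<tau>"
    show "\<sigma> v = \<tau> v"
    proof (cases "v < n")
      case True
      then show ?thesis using fun_cong[OF st(3), of v] by (simp add: f_def s_eq)
    next
      case False
      then show ?thesis using st by (auto simp: S_def configs_def PiE_def extensional_def)
    qed
  qed
  have mono: "mono_edges E (f \<sigma>) = mono_edges E \<sigma>" for \<sigma>
  proof -
    have "(\<exists>c. \<forall>v\<in>e. f \<sigma> v = c) \<longleftrightarrow> (\<exists>c. \<forall>v\<in>e. \<sigma> v = c)" if "e \<in> E" for e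
    proof -
      have "(\<exists>c. \<forall>v\<in>e. g v = c) \<longleftrightarrow> (\<forall>v\<in>e. \<forall>w\<in>e. g v = g w)" for g :: "nat \<Rightarrow> nat" by metis
      moreover have "f \<sigma> v = f \<sigma> w \<longleftrightarrow> \<sigma> v = \<sigma> w" if "v \<in> e" "w \<in> e" for v w
        using regular_graphs_edge_subset[OF E \<open>e \<in> E\<close>] that by (auto simp: f_def s_eq)
      ultimately show ?thesis by simp
    qed
    then have "{e \<in> E. \<exists>c. \<forall>v\<in>e. f \<sigma> v = c} = {e \<in> E. \<exists>c. \<forall>v\<in>e. \<sigma> v = c}" by blast
    then show ?thesis by (simp add: mono_edges_def)
  qed
  have sub: "f ` S \<subseteq> configs n q - S"
  proof
    fix \<tau> assume "\<tau> \<in> f ` S"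
    then obtain \<sigma> where \<sigma>: "\<sigma> \<in> S" "\<tau> = f \<sigma>" by auto
    have "\<sigma> v < q" if "v < n" for v using \<sigma> that by (auto simp: S_def configs_def PiE_iff)
    then have "\<tau> \<in> configs n q"
      using q \<sigma>(2) by (auto simp: configs_def f_def extensional_def s_def Transposition.transpose_def)
    moreover have "\<not> card {v. v < n \<and> \<tau> v \<noteq> 0} \<le> k"
    proof
      assume c: "card {v. v < n \<and> \<tau> v \<noteq> 0} \<le> k"
      \<comment> \<open>A vertex of colour 0 in \<open>\<sigma>\<close> has colour 1 in
        \<open>\<tau>\<close>.\<close>
      have "{..<n} \<subseteq> {v. v < n \<and> \<tau> v \<noteq> 0} \<union> {v. v < n \<and> \<sigma> v \<noteq> 0}"
        using \<sigma>(2) by (auto simp: f_def s_def Transposition.transpose_def)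
      then have "n \<le> card ({v. v < n \<and> \<tau> v \<noteq> 0} \<union> {v. v < n \<and> \<sigma> v \<noteq> 0})"
        using card_mono[of "{v. v < n \<and> \<tau> v \<noteq> 0} \<union> {v. v < n \<and> \<sigma> v \<noteq> 0}" "{..<n}"] by simp
      also have "\<dots> \<le> k + k" using c \<sigma>(1) by (intro order.trans[OF card_Un_le] add_mono) (auto simp: S_def)
      finally show False using k by simp
    qed
    ultimately show "\<tau> \<in> configs n q - S" by (simp add: S_def)
  qed
  have "(\<Sum>\<sigma>\<in>S. lam ^ mono_edges E \<sigma>) = (\<Sum>\<sigma>\<in>f ` S. lam ^ mono_edges E \<sigma>)"
    by (simp add: sum.reindex[OF inj] mono)
  also have "\<dots> \<le> (\<Sum>\<sigma>\<in>configs n q - S. lam ^ mono_edges E \<sigma>)"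
    using sub lam finite_configs by (intro sum_mono2) auto
  finally show ?thesis .
qed

text \<open>The number \<open>r\<close> bounds the layer weight in units of
  \<open>lam ^ card E\<close>, the weight of a constant configuration. That configuration lies in
  \<open>S\<close>, so no finer estimate of the mass of \<open>S\<close> is required.\<close>

lemma mixing_time_ge:
  fixes lam r T :: real
  assumes E: "E \<in> regular_graphs n \<Delta>" and lam: "lam \<ge> 1" and q: "q \<ge> 2" and k: "0 < k" "2 * k < n"
    and B: "(\<Sum>\<sigma>\<in>{\<sigma> \<in> configs n q. card {v. v < n \<and> \<sigma> v \<noteq> 0} = k}. lam ^ mono_edges E \<sigma>)
      \<le> lam ^ card E * r" and T: "T * r \<le> 1 / 16" "T \<ge> 0"
  shows "mixing_time n E lam q \<ge> ereal T"
proof (rule ccontr)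
  assume "\<not> mixing_time n E lam q \<ge> ereal T"
  then have lt: "mixing_time n E lam q < ereal T" by simp
  let ?S = "{\<sigma> \<in> configs n q. card {v. v < n \<and> \<sigma> v \<noteq> 0} \<le> k}"
  let ?B = "{\<sigma> \<in> configs n q. card {v. v < n \<and> \<sigma> v \<noteq> 0} = k}"
  let ?w = "\<lambda>\<sigma>. lam ^ mono_edges E \<sigma>"
  let ?\<pi> = "gibbs n E lam q"
  define Z where "Z = (\<Sum>\<sigma>\<in>configs n q. ?w \<sigma>)"
  note simple = regular_graphs_simple[OF E]
  have Z: "Z > 0" unfolding Z_def using partition_function_pos[of q lam E n] lam q by simp
  have pi_sum_eq: "(\<Sum>\<sigma>\<in>A. ?\<pi> \<sigma>) = (\<Sum>\<sigma>\<in>A. ?w \<sigma>) / Z" for A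
    by (simp add: gibbs_def Z_def sum_divide_distrib)
  interpret finite_chain "configs n q" "glauber_P n E lam q" "glauber_Pt n E lam q" ?\<pi>
    using simple lam k q by (intro glauber_finite_chain) auto
  \<comment> \<open>One update changes one vertex, so fewer than \<open>k\<close> non-0 vertices
    cannot become more than \<open>k\<close>.\<close>
  have exit: "glauber_P n E lam q X Y = 0" if X: "X \<in> ?S - ?B" and Y: "Y \<in> configs n q - ?S" for X Y
  proof -
    have "X(v := c) \<noteq> Y" if "v < n" "c < q" for v c
    proof
      assume "X(v := c) = Y"
      then have "{w. w < n \<and> Y w \<noteq> 0} \<subseteq> insert v {w. w < n \<and> X w \<noteq> 0}" by auto
      then have "card {w. w < n \<and> Y w \<noteq> 0} \<le> card (insert v {w. w < n \<and> X w \<noteq> 0})"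
        by (intro card_mono) auto
      also have "\<dots> \<le> Suc (card {w. w < n \<and> X w \<noteq> 0})" by (rule card_insert_le_m1) auto
      finally show False using X Y by auto
    qed
    then show ?thesis by (simp add: glauber_P_def)
  qed
  have mix: "\<exists>t. real t < T \<and> 1 / 2 * (\<Sum>Y\<in>configs n q. \<bar>glauber_Pt n E lam q t X Y - ?\<pi> Y\<bar>) \<le> 1 / (2 * exp 1)"
    if X: "X \<in> configs n q" for X
  proof -
    \<comment> \<open>If no \<open>t\<close> qualified, the infimum would be infinite; being below
      \<open>T\<close>, it yields an actual mixed time below \<open>T\<close>.\<close>
    have "(INF t\<in>{t. tv_dist n E lam q t X \<le> 1 / (2 * exp 1)}. ereal (real t)) \<le> mixing_time n E lam q"
      unfolding mixing_time_def by (rule SUP_upper[OF X])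
    then have "(INF t\<in>{t. tv_dist n E lam q t X \<le> 1 / (2 * exp 1)}. ereal (real t)) < ereal T"
      using lt by (rule order.strict_trans1)
    then show ?thesis unfolding INF_less_iff tv_dist_def by auto
  qed
  have main: "((\<Sum>Y\<in>configs n q - ?S. ?\<pi> Y) - 1 / (2 * exp 1)) * (\<Sum>X\<in>?S. ?\<pi> X) \<le> T * (\<Sum>X\<in>?B. ?\<pi> X)"
    using exit mix configs_nonempty q by (intro bottleneck_mixing) auto
  have split: "(\<Sum>\<sigma>\<in>configs n q. ?\<pi> \<sigma>) = (\<Sum>\<sigma>\<in>configs n q - ?S. ?\<pi> \<sigma>) + (\<Sum>\<sigma>\<in>?S. ?\<pi> \<sigma>)"
    using finite_configs by (intro sum.subset_diff) auto
  have "(\<Sum>\<sigma>\<in>?S. ?\<pi> \<sigma>) \<le> (\<Sum>\<sigma>\<in>configs n q - ?S. ?\<pi> \<sigma>)"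
    unfolding pi_sum_eq using Z minority_weight_le[OF E _ q k(2), of lam] lam
    by (intro divide_right_mono) auto
  then have half: "(\<Sum>\<sigma>\<in>configs n q - ?S. ?\<pi> \<sigma>) \<ge> 1 / 2" using split pi_sum by linarith
  have e2: "exp 1 \<ge> (2::real)" using exp_ge_add_one_self[of 1] by simp
  have "1 / (2 * exp 1) \<le> (1 / 4 :: real)" using e2 by (simp add: field_simps)
  with half have quarter: "(\<Sum>\<sigma>\<in>configs n q - ?S. ?\<pi> \<sigma>) - 1 / (2 * exp 1) \<ge> 1 / 4" by linarith
  let ?\<sigma>0 = "\<lambda>v\<in>{0..<n}. 0::nat"
  have "?\<sigma>0 \<in> ?S" using q by (auto simp: configs_def)
  then have "?w ?\<sigma>0 \<le> (\<Sum>\<sigma>\<in>?S. ?w \<sigma>)" using lam finite_configs by (intro member_le_sum[of _ _ ?w]) (simp_all del: restrict_apply)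
  moreover have "mono_edges E ?\<sigma>0 = card E"
  proof -
    have "\<forall>v\<in>e. ?\<sigma>0 v = 0" if "e \<in> E" for e using regular_graphs_edge_subset[OF E that] by auto
    then have "{e \<in> E. \<exists>c. \<forall>v\<in>e. ?\<sigma>0 v = c} = E" by blast
    then show ?thesis by (simp add: mono_edges_def)
  qed
  ultimately have S: "lam ^ card E / Z \<le> (\<Sum>\<sigma>\<in>?S. ?\<pi> \<sigma>)"
    unfolding pi_sum_eq using Z by (intro divide_right_mono) auto
  \<comment> \<open>The contradiction: the same product is at least 1/4 and at most 1/16 of the mass
    of the constant configuration.\<close>
  have "1 / 4 * (lam ^ card E / Z) \<le> ((\<Sum>Y\<in>configs n q - ?S. ?\<pi> Y) - 1 / (2 * exp 1)) * (\<Sum>X\<in>?S. ?\<pi> X)"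
    using quarter S Z lam by (intro mult_mono) auto
  also note main
  also have "T * (\<Sum>X\<in>?B. ?\<pi> X) \<le> T * (lam ^ card E * r / Z)"
    unfolding pi_sum_eq using B Z T by (intro mult_left_mono divide_right_mono) auto
  also have "\<dots> = T * r * (lam ^ card E / Z)" by simp
  also have "\<dots> \<le> 1 / 16 * (lam ^ card E / Z)" using T Z lam by (intro mult_right_mono) auto
  finally show False using Z lam by (simp add: field_simps)
qed

subsection \<open>Switchings in regular graphs\<close>

text \<open>The orientation of both edges matters: \<open>x\<close> is joined to \<open>u\<close>
  and \<open>y\<close> to \<open>v\<close>, so the two darts of an edge \<open>{x, y}\<close> give
  two different switchings.\<close>

definition switch :: "nat set set \<Rightarrow> nat \<Rightarrow> nat \<Rightarrow> nat \<Rightarrow> nat \<Rightarrow> nat set set" where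
  "switch E u v x y = (E - {{u, v}, {x, y}}) \<union> {{x, u}, {y, v}}"

locale switching =
  fixes E u v x y n \<Delta>
  assumes E: "E \<in> regular_graphs n \<Delta>" and uv: "{u, v} \<in> E" and xy: "{x, y} \<in> E"
    and xu: "{x, u} \<notin> E" "x \<noteq> u" and yv: "{y, v} \<notin> E" "y \<noteq> v"
begin

lemma distinct_ends: "u \<noteq> v" "x \<noteq> y" "x \<noteq> v" "y \<noteq> u"
  using uv xy xu yv simple_edges_irrefl[OF regular_graphs_simple[OF E]] by (auto simp: insert_commute)

lemma switch_mem: "switch E u v x y \<in> regular_graphs n \<Delta>"
proof (rule regular_graphsI)
  note s = regular_graphs_simple[OF E]
  show simple: "simple_edges (switch E u v x y)"
    using s xu yv by (auto simp: simple_edges_def switch_def)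
  have lt: "u < n" "v < n" "x < n" "y < n"
    using regular_graphs_edge_subset[OF E uv] regular_graphs_edge_subset[OF E xy] by auto
  show "e \<subseteq> {..<n}" if "e \<in> switch E u v x y" for e
    using that regular_graphs_edge_subset[OF E] lt by (auto simp: switch_def)
  fix z assume z: "z < n"
  \<comment> \<open>The degree of \<open>z\<close> is the sum of this indicator over the edges. Both
    the removed and the added pair of edges cover each of the ends \<open>u\<close>,
    \<open>v\<close>, \<open>x\<close>, \<open>y\<close> equally often.\<close>
  let ?f = "\<lambda>e. if z \<in> e then 1 else 0 :: nat"
  have deg: "degree F z = sum ?f F" if "simple_edges F" for F
    using that by (simp add: degree_eq_card_incident sum.If_cases simple_edges_finite Int_def)
  have fE: "finite E" using s simple_edges_finite by blast
  have ne: "{u, v} \<noteq> {x, y}" "{x, u} \<noteq> {y, v}"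
    using distinct_ends xu yv by (auto simp: doubleton_eq_iff)
  have "sum ?f E = sum ?f (E - {{u, v}, {x, y}}) + sum ?f {{u, v}, {x, y}}"
    using fE uv xy by (intro sum.subset_diff) auto
  moreover have "sum ?f (switch E u v x y) = sum ?f (E - {{u, v}, {x, y}}) + sum ?f {{x, u}, {y, v}}"
    unfolding switch_def using fE xu yv by (intro sum.union_disjoint) auto
  moreover have "sum ?f {{u, v}, {x, y}} = ?f {u, v} + ?f {x, y}" using ne by (subst sum.insert) auto
  moreover have "sum ?f {{x, u}, {y, v}} = ?f {x, u} + ?f {y, v}" using ne by (subst sum.insert) auto
  moreover have "?f {u, v} + ?f {x, y} = ?f {x, u} + ?f {y, v}"
    using distinct_ends xu yv by auto
  ultimately have "sum ?f (switch E u v x y) = sum ?f E" by linarith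
  then show "degree (switch E u v x y) z = \<Delta>"
    using regular_graphs_degree[OF E z] deg[OF s] deg[OF simple] by simp
qed

lemma switch_undo: "E = (switch E u v x y - {{x, u}, {y, v}}) \<union> {{u, v}, {x, y}}"
proof -
  have "{u, v} \<noteq> {x, u}" "{u, v} \<noteq> {y, v}" "{x, y} \<noteq> {x, u}" "{x, y} \<noteq> {y, v}"
    using distinct_ends xu yv by (auto simp: doubleton_eq_iff)
  then show ?thesis using uv xy xu yv by (auto simp: switch_def)
qed

end

lemma card_darts:
  assumes "simple_edges E" "finite W"
  shows "card (SIGMA x:W. {y. {y, x} \<in> E}) = (\<Sum>x\<in>W. degree E x)"
  using assms finite_nbrs by (subst card_SigmaI) (auto simp: degree_def)

text \<open>There are \<open>\<Delta> * n\<close> darts (ordered edges). At most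
  \<open>2 * card M\<close> of them lie in \<open>M\<close>; a further dart is bad only if its first
  end is in the closed neighbourhood of \<open>u\<close> or its second end in that of
  \<open>v\<close>. Each such neighbourhood has at most \<open>\<Delta> + 1\<close> vertices, hence
  at most \<open>\<Delta> * (\<Delta> + 1)\<close> darts.\<close>

lemma card_switchable_darts:
  assumes E: "E \<in> regular_graphs n \<Delta>" and M: "M \<subseteq> E"
  shows "real (card {(x, y). {x, y} \<in> E \<and> {x, y} \<notin> M \<and> {x, u} \<notin> E \<and> x \<noteq> u \<and> {y, v} \<notin> E \<and> y \<noteq> v})
    \<ge> real \<Delta> * real n - 2 * real (card M) - 2 * real \<Delta> * (real \<Delta> + 1)"
proof -
  let ?good = "{(x, y). {x, y} \<in> E \<and> {x, y} \<notin> M \<and> {x, u} \<notin> E \<and> x \<noteq> u \<and> {y, v} \<notin> E \<and> y \<noteq> v}"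
  let ?D = "\<lambda>F W. SIGMA x:W. {y. {y, x} \<in> F}"
  let ?N = "\<lambda>w. insert w {x. {x, w} \<in> E}"
  note s = regular_graphs_simple[OF E]
  have sM: "simple_edges M" using s M simple_edges_subset by blast
  have lt: "x < n" "y < n" if "{x, y} \<in> E" for x y using regular_graphs_edge_subset[OF E that] by auto
  have finN: "finite (?N w)" for w using finite_nbrs[OF s] by simp
  have total: "card (?D E {..<n}) = \<Delta> * n"
    using regular_graphs_degree[OF E] by (simp add: card_darts[OF s])
  have inM: "card (?D M {..<n}) = 2 * card M"
    using sM M regular_graphs_edge_subset[OF E]
    by (subst card_darts[OF sM]) (auto intro!: sum_degree_subset)
  have bad: "card (?D E (?N w)) \<le> \<Delta> * (\<Delta> + 1)" for w
  proof -
    have "card (?D E (?N w)) \<le> card (?N w) * \<Delta>"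
      unfolding card_darts[OF s finN] using regular_graphs_degree_le[OF E]
      using sum_bounded_above[of "?N w" "degree E" \<Delta>] by simp
    also have "card (?N w) \<le> \<Delta> + 1"
      using card_insert_le_m1[of "Suc (Suc \<Delta>)"] regular_graphs_degree_le[OF E, of w] finite_nbrs[OF s, of w]
      by (auto simp: degree_def card_insert_if)
    finally show ?thesis by (simp add: mult.commute)
  qed
  have fin: "finite (?D E W)" if "finite W" for W using that finite_nbrs[OF s] by auto
  have finM: "finite (?D M {..<n})" using finite_nbrs[OF sM] by auto
  have fing: "finite ?good"
    by (rule finite_subset[of _ "{..<n} \<times> {..<n}"]) (auto dest: lt)
  have "?D E {..<n} \<subseteq> ((?good \<union> ?D M {..<n}) \<union> ?D E (?N u)) \<union> prod.swap ` ?D E (?N v)"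
  proof
    fix p assume "p \<in> ?D E {..<n}"
    then obtain x y where p: "p = (x, y)" "{x, y} \<in> E" "x < n" by (auto simp: insert_commute)
    show "p \<in> ((?good \<union> ?D M {..<n}) \<union> ?D E (?N u)) \<union> prod.swap ` ?D E (?N v)"
    proof (cases "y \<in> ?N v")
      case True
      then have "(y, x) \<in> ?D E (?N v)" using p by auto
      then have "p \<in> prod.swap ` ?D E (?N v)" using p by force
      then show ?thesis by blast
    next
      case False
      then show ?thesis using p by (auto simp: insert_commute)
    qed
  qed
  then have "card (?D E {..<n}) \<le> card (((?good \<union> ?D M {..<n}) \<union> ?D E (?N u)) \<union> prod.swap ` ?D E (?N v))"
    using fing finM fin finN by (intro card_mono finite_UnI finite_imageI) auto
  also have "\<dots> \<le> card ?good + card (?D M {..<n}) + card (?D E (?N u)) + card (prod.swap ` ?D E (?N v))"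
    by (intro order.trans[OF card_Un_le] add_mono order.refl)
  also have "card (prod.swap ` ?D E (?N v)) \<le> card (?D E (?N v))"
    using fin finN by (intro card_image_le) auto
  finally have "\<Delta> * n \<le> card ?good + 2 * card M + 2 * (\<Delta> * (\<Delta> + 1))"
    using total inM bad[of u] bad[of v] by linarith
  then have "real (\<Delta> * n) \<le> real (card ?good + 2 * card M + 2 * (\<Delta> * (\<Delta> + 1)))"
    by (rule of_nat_mono)
  then show ?thesis by (simp add: algebra_simps)
qed

lemma card_nbrs_diff:
  assumes "E \<in> regular_graphs n \<Delta>" "M \<subseteq> E" "w < n"
  shows "real (card {x. {x, w} \<in> E - M}) = real \<Delta> - real (degree M w)"
proof -
  have s: "simple_edges E" using assms regular_graphs_simple by blast
  have "{x. {x, w} \<in> E - M} = {x. {x, w} \<in> E} - {x. {x, w} \<in> M}" by auto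
  then have "card {x. {x, w} \<in> E - M} = degree E w - degree M w"
    unfolding degree_def using assms finite_nbrs[OF simple_edges_subset[OF s assms(2)]]
    by (simp add: card_Diff_subset Collect_mono_iff subset_iff)
  then show ?thesis using regular_graphs_degree[OF assms(1,3)] degree_subset_le[OF s assms(2), of w] by simp
qed

text \<open>Double counting of triples \<open>(E, x, y)\<close> with \<open>E\<close> containing
  \<open>M\<close> and \<open>uv\<close> and \<open>(x, y)\<close> switchable. Each such
  \<open>E\<close> has many switchable darts. The switched graph still contains \<open>M\<close>,
  and there \<open>x\<close> and \<open>y\<close> are neighbours of \<open>u\<close> and
  \<open>v\<close> through edges outside \<open>M\<close>, which leaves
  \<open>\<Delta> - degree M u\<close> and \<open>\<Delta> - degree M v\<close> choices. Given
  \<open>x\<close> and \<open>y\<close> the switching can be undone, so no triple is counted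
  twice.\<close>

lemma switching_count:
  fixes \<Delta> :: nat
  assumes uv: "u < n" "v < n" "{u, v} \<notin> M"
  defines "N \<equiv> \<lambda>M. {E \<in> regular_graphs n \<Delta>. M \<subseteq> E}"
  shows "real (card (N (insert {u, v} M))) *
      (real \<Delta> * real n - 2 * real (card M) - 2 * real \<Delta> * (real \<Delta> + 1))
    \<le> real (card (N M)) * ((real \<Delta> - degree M u) * (real \<Delta> - degree M v))"
proof -
  define good where "good E = {(x, y). {x, y} \<in> E \<and> {x, y} \<notin> M \<and> {x, u} \<notin> E \<and> x \<noteq> u \<and> {y, v} \<notin> E \<and> y \<noteq> v}" for E
  let ?A = "N (insert {u, v} M)"
  let ?src = "Sigma ?A good"
  let ?nb = "\<lambda>F w. {x. {x, w} \<in> F - M}"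
  let ?tgt = "SIGMA F:N M. ?nb F u \<times> ?nb F v"
  let ?\<phi> = "\<lambda>(E, x, y). (switch E u v x y, x, y)"
  have finN: "finite (N M)" for M unfolding N_def using finite_regular_graphs by simp
  have fing: "finite (good E)" if "E \<in> ?A" for E
  proof -
    have "E \<in> regular_graphs n \<Delta>" using that by (simp add: N_def)
    then have "good E \<subseteq> {..<n} \<times> {..<n}" by (auto simp: good_def dest: regular_graphs_edge_subset)
    then show ?thesis using finite_subset by blast
  qed
  have finnb: "finite (?nb F w)" if "F \<in> N M" for F w
    using that finite_subset[OF _ finite_nbrs[OF regular_graphs_simple], of _ w F n \<Delta>]
    by (auto simp: N_def)
  have sw: "switching E u v x y n \<Delta>" if "E \<in> ?A" "(x, y) \<in> good E" for E x y
    using that by (auto simp: N_def good_def switching_def)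
  have inj: "inj_on ?\<phi> ?src"
  proof (rule inj_onI, clarsimp)
    fix E F x y assume EF: "E \<in> ?A" "F \<in> ?A" "(x, y) \<in> good E" "(x, y) \<in> good F"
      and eq: "switch E u v x y = switch F u v x y"
    show "E = F"
      using switching.switch_undo[OF sw[OF EF(1,3)]] switching.switch_undo[OF sw[OF EF(2,4)]] eq by simp
  qed
  have sub: "?\<phi> ` ?src \<subseteq> ?tgt"
  proof clarsimp
    fix E x y assume a: "E \<in> ?A" "(x, y) \<in> good E"
    have "switch E u v x y \<in> regular_graphs n \<Delta>" using switching.switch_mem[OF sw[OF a]] .
    moreover have "M \<subseteq> switch E u v x y" using a uv by (auto simp: N_def good_def switch_def)
    moreover have "{x, u} \<in> switch E u v x y" "{y, v} \<in> switch E u v x y" by (auto simp: switch_def)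
    moreover have "{x, u} \<notin> M" "{y, v} \<notin> M" using a by (auto simp: N_def good_def)
    ultimately show "switch E u v x y \<in> N M \<and> {x, u} \<in> switch E u v x y \<and> {x, u} \<notin> M \<and>
        {y, v} \<in> switch E u v x y \<and> {y, v} \<notin> M" by (simp add: N_def)
  qed
  have "real (card ?A) * (real \<Delta> * real n - 2 * real (card M) - 2 * real \<Delta> * (real \<Delta> + 1))
      = (\<Sum>E\<in>?A. real \<Delta> * real n - 2 * real (card M) - 2 * real \<Delta> * (real \<Delta> + 1))" by simp
  also have "\<dots> \<le> (\<Sum>E\<in>?A. real (card (good E)))"
    unfolding good_def by (intro sum_mono card_switchable_darts) (auto simp: N_def)
  also have "\<dots> = real (card ?src)" using finN fing by (subst card_SigmaI) auto
  also have "card ?src = card (?\<phi> ` ?src)" using inj by (simp add: card_image)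
  also have "real (card (?\<phi> ` ?src)) \<le> real (card ?tgt)"
    using sub finN finnb by (intro of_nat_mono card_mono finite_SigmaI finite_cartesian_product) auto
  also have "\<dots> = (\<Sum>F\<in>N M. real (card (?nb F u)) * real (card (?nb F v)))"
    using finN finnb by (subst card_SigmaI) (auto simp: card_cartesian_product)
  also have "\<dots> = (\<Sum>F\<in>N M. (real \<Delta> - degree M u) * (real \<Delta> - degree M v))"
    using uv by (intro sum.cong refl arg_cong2[of _ _ _ _ "(*)"] card_nbrs_diff) (auto simp: N_def)
  finally show ?thesis by simp
qed

subsection \<open>Small sets span few edges\<close>

definition pair_sets :: "nat set \<Rightarrow> nat \<Rightarrow> nat set set set" where
  "pair_sets U j = {M. M \<subseteq> {e. e \<subseteq> U \<and> card e = 2} \<and> card M = j}"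

lemma pair_sets_simple:
  assumes "finite U" "M \<in> pair_sets U j"
  shows "simple_edges M"
proof -
  have "M \<subseteq> Pow U" using assms by (auto simp: pair_sets_def)
  then have "finite M" using assms finite_subset by blast
  then show ?thesis using assms by (auto simp: simple_edges_def pair_sets_def)
qed

lemma finite_pair_sets: "finite U \<Longrightarrow> finite (pair_sets U j)"
  by (rule finite_subset[of _ "Pow (Pow U)"]) (auto simp: pair_sets_def)

lemma pair_sets_inner:
  assumes "simple_edges E"
  shows "{M \<in> pair_sets U j. M \<subseteq> E} = {M. M \<subseteq> inner_edges E U \<and> card M = j}"
  using assms by (auto simp: pair_sets_def inner_edges_def dest: simple_edges_card)

text \<open>Summed over all regular graphs, this expresses the j-th binomial moment of
  \<open>e(U)\<close> by the numbers of graphs containing a prescribed \<open>M\<close>.\<close>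

lemma card_pair_sets_inner:
  assumes "simple_edges E"
  shows "card {M \<in> pair_sets U j. M \<subseteq> E} = (card (inner_edges E U) choose j)"
  unfolding pair_sets_inner[OF assms] using n_subsets finite_inner_edges[OF assms] by blast

lemma card_darts_inner_diff:
  assumes E: "simple_edges E" and U: "finite U" and M: "M \<in> pair_sets U j" "M \<subseteq> E"
  shows "card {(u, v) \<in> U \<times> U. {u, v} \<in> E - M} = 2 * (card (inner_edges E U) - j)"
proof -
  let ?F = "inner_edges E U - M"
  have F: "simple_edges ?F"
    using E by (rule simple_edges_subset) (auto simp: inner_edges_def)
  have MU: "M \<subseteq> inner_edges E U" "card M = j" using M by (auto simp: inner_edges_def pair_sets_def)
  have "finite M" using MU finite_inner_edges[OF E] finite_subset by blast
  then have cF: "card ?F = card (inner_edges E U) - j" using MU by (simp add: card_Diff_subset)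
  have "{(u, v) \<in> U \<times> U. {u, v} \<in> E - M} = (SIGMA u:U. {v. {v, u} \<in> ?F})"
    by (auto simp: inner_edges_def insert_commute)
  then show ?thesis
    using card_darts[OF F U] sum_degree_subset[OF F U] cF by (auto simp: inner_edges_def)
qed

lemma Suc_times_choose: "Suc j * (e choose Suc j) = (e - j) * (e choose j)"
  using binomial_absorption binomial_absorb_comp by metis

text \<open>\<open>Suc j * (e choose Suc j)\<close> counts the ways to choose \<open>j\<close> inner
  edges \<open>M\<close> and one more inner edge; the factor 2 orients the latter. After exchanging
  the sums, \<open>switching_count\<close> bounds the number of graphs for each \<open>M\<close> and
  each pair.\<close>

lemma choose_moment_step:
  assumes U: "U \<subseteq> {..<n}"
    and W: "W = real \<Delta> * real n - 2 * real j - 2 * real \<Delta> * (real \<Delta> + 1)" "W \<ge> 0"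
  defines "B \<equiv> \<lambda>j. \<Sum>E\<in>regular_graphs n \<Delta>. real (card (inner_edges E U) choose j)"
  shows "2 * real (Suc j) * B (Suc j) * W \<le> (real \<Delta> * card U - 2 * real j)\<^sup>2 * B j"
proof -
  let ?R = "regular_graphs n \<Delta>"
  let ?N = "\<lambda>M. {E \<in> ?R. M \<subseteq> E}"
  let ?T = "pair_sets U j"
  have fU: "finite U" using U finite_subset by blast
  note fR = finite_regular_graphs[of n \<Delta>]
  note fT = finite_pair_sets[OF fU, of j]
  have Bj: "B j = (\<Sum>M\<in>?T. real (card (?N M)))"
  proof -
    have "B j = (\<Sum>E\<in>?R. \<Sum>M\<in>?T. if M \<subseteq> E then 1 else 0)"
      unfolding B_def
    proof (intro sum.cong refl)
      fix E assume "E \<in> ?R"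
      then show "real (card (inner_edges E U) choose j) = (\<Sum>M\<in>?T. if M \<subseteq> E then 1 else 0)"
        using fT card_pair_sets_inner[OF regular_graphs_simple, of E n \<Delta> U j]
        by (simp add: sum.If_cases Int_def)
    qed
    also have "\<dots> = (\<Sum>M\<in>?T. \<Sum>E\<in>?R. if M \<subseteq> E then 1 else 0)" by (rule sum.swap)
    also have "\<dots> = (\<Sum>M\<in>?T. real (card (?N M)))"
      using fR by (intro sum.cong refl) (simp add: sum.If_cases Int_def)
    finally show ?thesis .
  qed
  have "2 * real (Suc j) * B (Suc j) = (\<Sum>E\<in>?R. 2 * real (Suc j * (card (inner_edges E U) choose Suc j)))"
    unfolding B_def by (simp only: sum_distrib_left mult.assoc of_nat_mult)
  also have "\<dots> = (\<Sum>E\<in>?R. \<Sum>M\<in>?T. \<Sum>p\<in>U \<times> U. if M \<subseteq> E \<and> {fst p, snd p} \<in> E - M then 1 else 0)"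
  proof (intro sum.cong refl)
    fix E assume E: "E \<in> ?R"
    note s = regular_graphs_simple[OF E]
    let ?e = "card (inner_edges E U)"
    have "(\<Sum>M\<in>?T. \<Sum>p\<in>U \<times> U. if M \<subseteq> E \<and> {fst p, snd p} \<in> E - M then 1 else 0 :: real)
        = (\<Sum>M\<in>?T. if M \<subseteq> E then 2 * real (?e - j) else 0)"
    proof (intro sum.cong refl)
      fix M assume M: "M \<in> ?T"
      show "(\<Sum>p\<in>U \<times> U. if M \<subseteq> E \<and> {fst p, snd p} \<in> E - M then 1 else 0 :: real) =
          (if M \<subseteq> E then 2 * real (?e - j) else 0)"
      proof (cases "M \<subseteq> E")
        case True
        have "{(u, v) \<in> U \<times> U. {u, v} \<in> E - M} = {p \<in> U \<times> U. {fst p, snd p} \<in> E - M}" by auto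
        then have "card {p \<in> U \<times> U. {fst p, snd p} \<in> E - M} = 2 * (?e - j)"
          using card_darts_inner_diff[OF s fU M True] by simp
        then have "real (card {p \<in> U \<times> U. {fst p, snd p} \<in> E - M}) = 2 * real (?e - j)" by simp
        then show ?thesis using True fU by (simp add: sum.If_cases Int_def)
      qed simp
    qed
    also have "\<dots> = real (card {M \<in> ?T. M \<subseteq> E}) * (2 * real (?e - j))"
      using fT by (simp add: sum.If_cases Int_def)
    also have "\<dots> = 2 * real ((?e - j) * (?e choose j))" using card_pair_sets_inner[OF s, of U j] by simp
    finally show "2 * real (Suc j * (?e choose Suc j)) =
        (\<Sum>M\<in>?T. \<Sum>p\<in>U \<times> U. if M \<subseteq> E \<and> {fst p, snd p} \<in> E - M then 1 else 0)"
      by (simp only: Suc_times_choose)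
  qed
  also have "\<dots> = (\<Sum>M\<in>?T. \<Sum>p\<in>U \<times> U. \<Sum>E\<in>?R. if M \<subseteq> E \<and> {fst p, snd p} \<in> E - M then 1 else 0)"
    by (subst sum.swap, intro sum.cong refl, rule sum.swap)
  finally have eq: "2 * real (Suc j) * B (Suc j) =
      (\<Sum>M\<in>?T. \<Sum>p\<in>U \<times> U. \<Sum>E\<in>?R. if M \<subseteq> E \<and> {fst p, snd p} \<in> E - M then 1 else 0)" .
  have "2 * real (Suc j) * B (Suc j) * W =
      (\<Sum>M\<in>?T. \<Sum>p\<in>U \<times> U. (\<Sum>E\<in>?R. if M \<subseteq> E \<and> {fst p, snd p} \<in> E - M then 1 else 0) * W)"
    unfolding eq sum_distrib_right ..
  also have "\<dots> \<le> (\<Sum>M\<in>?T. \<Sum>p\<in>U \<times> U. real (card (?N M)) *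
      ((real \<Delta> - degree M (fst p)) * (real \<Delta> - degree M (snd p))))"
  proof (intro sum_mono)
    fix M p assume M: "M \<in> ?T" and p: "p \<in> U \<times> U"
    obtain u v where uv: "p = (u, v)" by (cases p)
    have lt: "u < n" "v < n" using p U uv by auto
    \<comment> \<open>If some regular graph contains \<open>M\<close>, its degrees are at most
      \<open>\<Delta>\<close>; otherwise the first factor vanishes. This settles pairs already in
      \<open>M\<close>, whose left side is 0.\<close>
    have nonneg: "0 \<le> real (card (?N M)) * ((real \<Delta> - degree M u) * (real \<Delta> - degree M v))"
    proof (cases "?N M = {}")
      case False
      then obtain E where "E \<in> ?R" "M \<subseteq> E" by auto
      then have "degree M w \<le> \<Delta>" for w
        using degree_subset_le[OF regular_graphs_simple] regular_graphs_degree_le order.trans by metis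
      then show ?thesis by (intro mult_nonneg_nonneg) auto
    next
      case True
      then show ?thesis by (simp only: card.empty of_nat_0 mult_zero_left order.refl)
    qed
    show "(\<Sum>E\<in>?R. if M \<subseteq> E \<and> {fst p, snd p} \<in> E - M then 1 else 0) * W \<le> real (card (?N M)) *
      ((real \<Delta> - degree M (fst p)) * (real \<Delta> - degree M (snd p)))"
    proof (cases "{u, v} \<in> M")
      case True
      then show ?thesis using nonneg uv by simp
    next
      case False
      have "(\<Sum>E\<in>?R. if M \<subseteq> E \<and> {fst p, snd p} \<in> E - M then 1 else 0) = real (card (?N (insert {u, v} M)))"
        using fR False uv by (simp add: sum.If_cases Int_def conj_commute)
      then show ?thesis
        using switching_count[OF lt False, of \<Delta>] W M uv by (simp add: pair_sets_def)
    qed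
  qed
  \<comment> \<open>Summing over all ordered pairs, diagonal included, gives the square of the total
    free degree in \<open>U\<close>, of which the \<open>j\<close> edges of \<open>M\<close> use up
    \<open>2 * j\<close>.\<close>
  also have "\<dots> = (\<Sum>M\<in>?T. real (card (?N M)) * (real \<Delta> * card U - 2 * real j)\<^sup>2)"
  proof (intro sum.cong refl)
    fix M assume M: "M \<in> ?T"
    have "(\<Sum>w\<in>U. degree M w) = 2 * j"
      using sum_degree_subset[OF pair_sets_simple[OF fU M] fU] M by (auto simp: pair_sets_def)
    then have "real (\<Sum>w\<in>U. degree M w) = 2 * real j" by simp
    then have tot: "(\<Sum>w\<in>U. real \<Delta> - degree M w) = real \<Delta> * card U - 2 * real j"
      by (simp add: sum_subtractf)
    have "(\<Sum>p\<in>U \<times> U. (real \<Delta> - degree M (fst p)) * (real \<Delta> - degree M (snd p))) =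
        (\<Sum>w\<in>U. real \<Delta> - degree M w)\<^sup>2"
      by (simp add: power2_eq_square sum_product sum.cartesian_product case_prod_unfold)
    then show "(\<Sum>p\<in>U \<times> U. real (card (?N M)) *
        ((real \<Delta> - degree M (fst p)) * (real \<Delta> - degree M (snd p)))) =
        real (card (?N M)) * (real \<Delta> * card U - 2 * real j)\<^sup>2"
      using tot by (simp flip: sum_distrib_left)
  qed
  also have "\<dots> = (real \<Delta> * card U - 2 * real j)\<^sup>2 * B j"
    unfolding Bj by (simp add: sum_distrib_left mult.commute)
  finally show ?thesis .
qed

text \<open>Each application of \<open>choose_moment_step\<close> costs a factor at most
  \<open>\<rho> / (j + 1)\<close>, uniformly in \<open>j\<close>. Edges already placed reduce both
  the free degree in \<open>U\<close> and the supply \<open>W\<close> of darts, but the former by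
  the larger proportion, as \<open>k < d\<close>.\<close>

lemma choose_moment_le:
  assumes U: "U \<subseteq> {..<n}" "card U = k" and \<Delta>: "\<Delta> > 0"
    and k: "real k < real n - 2 * (real \<Delta> + 1)"
    and m: "\<And>j. j < m \<Longrightarrow> 2 * j \<le> \<Delta> * k"
  shows "fact m * (\<Sum>E\<in>regular_graphs n \<Delta>. real (card (inner_edges E U) choose m))
    \<le> (real \<Delta> * (real k)\<^sup>2 / (2 * (real n - 2 * (real \<Delta> + 1)))) ^ m * card (regular_graphs n \<Delta>)"
  using m
proof (induction m)
  case (Suc j)
  let ?B = "\<lambda>j. \<Sum>E\<in>regular_graphs n \<Delta>. real (card (inner_edges E U) choose j)"
  define d where "d = real n - 2 * (real \<Delta> + 1)"
  define \<rho> where "\<rho> = real \<Delta> * (real k)\<^sup>2 / (2 * d)"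
  define W where "W = real \<Delta> * d - 2 * real j"
  have "real (2 * j) \<le> real (\<Delta> * k)" using Suc.prems[of j] by (intro of_nat_mono) auto
  then have jk: "2 * real j \<le> real \<Delta> * real k" by simp
  have d: "d > 0" "real k < d" using k by (auto simp: d_def)
  have "real \<Delta> * real k < real \<Delta> * d" using d \<Delta> by simp
  then have W: "W > 0" using jk by (simp add: W_def)
  have B0: "?B i \<ge> 0" for i by (intro sum_nonneg) auto
  have "(real \<Delta> * k - 2 * real j)\<^sup>2 * d \<le> real \<Delta> * k * (real \<Delta> * k - 2 * real j) * d"
    unfolding power2_eq_square using jk d by (intro mult_right_mono) auto
  also have "\<dots> \<le> real \<Delta> * k * (k * W)"
  proof -
    \<comment> \<open>One factor of the square is bounded by \<open>\<Delta> * k\<close>; the other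
      is compared with \<open>W\<close> here.\<close>
    have "real j * real k \<le> real j * d" using d by (intro mult_left_mono) auto
    then have "(real \<Delta> * k - 2 * real j) * d \<le> k * W" by (simp add: W_def algebra_simps)
    then have "real \<Delta> * k * ((real \<Delta> * k - 2 * real j) * d) \<le> real \<Delta> * k * (k * W)"
      by (intro mult_left_mono) auto
    then show ?thesis by (simp add: mult.assoc)
  qed
  finally have "(real \<Delta> * k - 2 * real j)\<^sup>2 * d \<le> 2 * d * \<rho> * W"
    using d by (simp add: \<rho>_def power2_eq_square mult_ac)
  then have sq: "(real \<Delta> * k - 2 * real j)\<^sup>2 \<le> 2 * \<rho> * W" using d by (simp add: mult_ac)
  have "2 * real (Suc j) * ?B (Suc j) * W \<le> (real \<Delta> * card U - 2 * real j)\<^sup>2 * ?B j"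
    using W by (intro choose_moment_step U) (auto simp: W_def d_def algebra_simps)
  also have "\<dots> \<le> 2 * \<rho> * W * ?B j" unfolding U(2) using sq B0 by (intro mult_right_mono) auto
  finally have "2 * W * (real (Suc j) * ?B (Suc j)) \<le> 2 * W * (\<rho> * ?B j)" by (simp only: mult_ac)
  then have step: "real (Suc j) * ?B (Suc j) \<le> \<rho> * ?B j" by (rule mult_left_le_imp_le) (use W in simp)
  have \<rho>: "\<rho> \<ge> 0" using d by (simp add: \<rho>_def)
  have "fact (Suc j) * ?B (Suc j) = fact j * (real (Suc j) * ?B (Suc j))" by (simp only: fact_Suc) simp
  also have "\<dots> \<le> fact j * (\<rho> * ?B j)" using step by (intro mult_left_mono) auto
  also have "\<dots> = \<rho> * (fact j * ?B j)" by simp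
  also have "\<dots> \<le> \<rho> * (\<rho> ^ j * card (regular_graphs n \<Delta>))"
    using Suc.IH Suc.prems \<rho> unfolding \<rho>_def d_def by (intro mult_left_mono) auto
  finally show ?case by (simp add: \<rho>_def d_def mult.assoc)
qed simp

text \<open>First moment method: \<open>e(U) \<ge> m\<close> forces
  \<open>e(U) choose m \<ge> 1\<close>, and there are \<open>n choose k\<close> sets
  \<open>U\<close>.\<close>

lemma card_dense_graphs_le:
  assumes \<Delta>: "\<Delta> > 0" and k: "real k < real n - 2 * (real \<Delta> + 1)"
    and m: "\<And>j. j < m \<Longrightarrow> 2 * j \<le> \<Delta> * k"
  shows "real (card {E \<in> regular_graphs n \<Delta>. \<exists>U\<subseteq>{..<n}. card U = k \<and> card (inner_edges E U) \<ge> m})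
    \<le> real (n choose k) * ((real \<Delta> * (real k)\<^sup>2 / (2 * (real n - 2 * (real \<Delta> + 1)))) ^ m / fact m)
      * card (regular_graphs n \<Delta>)"
proof -
  let ?R = "regular_graphs n \<Delta>"
  let ?\<U> = "{U. U \<subseteq> {..<n} \<and> card U = k}"
  let ?D = "\<lambda>U. {E \<in> ?R. card (inner_edges E U) \<ge> m}"
  let ?b = "(real \<Delta> * (real k)\<^sup>2 / (2 * (real n - 2 * (real \<Delta> + 1)))) ^ m / fact m * card ?R"
  have each: "real (card (?D U)) \<le> ?b" if U: "U \<in> ?\<U>" for U
  proof -
    have "real (card (?D U)) = (\<Sum>E\<in>?D U. 1)" by simp
    also have "\<dots> \<le> (\<Sum>E\<in>?D U. real (card (inner_edges E U) choose m))"
      by (intro sum_mono) (simp add: Suc_le_eq)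
    also have "\<dots> \<le> (\<Sum>E\<in>?R. real (card (inner_edges E U) choose m))"
      using finite_regular_graphs by (intro sum_mono2) auto
    also have "\<dots> \<le> ?b"
      using choose_moment_le[of U n k \<Delta> m] U \<Delta> k m by (simp add: field_simps)
    finally show ?thesis .
  qed
  have "{E \<in> ?R. \<exists>U\<subseteq>{..<n}. card U = k \<and> card (inner_edges E U) \<ge> m} = (\<Union>U\<in>?\<U>. ?D U)" by auto
  then have "real (card {E \<in> ?R. \<exists>U\<subseteq>{..<n}. card U = k \<and> card (inner_edges E U) \<ge> m})
      \<le> real (\<Sum>U\<in>?\<U>. card (?D U))"
    by (simp only:) (intro of_nat_mono card_UN_le, simp)
  also have "\<dots> \<le> (\<Sum>U\<in>?\<U>. ?b)" unfolding of_nat_sum using each by (intro sum_mono)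
  also have "\<dots> = real (n choose k) * ?b" using n_subsets[of "{..<n}" k] by simp
  finally show ?thesis by (simp only: mult.assoc)
qed

subsection \<open>Existence of regular graphs\<close>

lemma add_mod_eq_if:
  fixes x d n :: nat
  assumes "x < n" "d < n"
  shows "(x + d) mod n = (if x + d < n then x + d else x + d - n)"
  using assms by (simp add: le_mod_geq)

text \<open>The circulant graph with connection set \<open>D\<close>. The reverse of a step by
  \<open>d\<close> is a step by \<open>n - d\<close>, so with \<open>D\<close> symmetric the
  neighbours of \<open>v\<close> are precisely the \<open>v + d\<close>.\<close>

lemma circulant_regular:
  assumes D: "D \<subseteq> {1..<n}" and sym: "\<And>d. d \<in> D \<Longrightarrow> n - d \<in> D"
  shows "{{v, (v + d) mod n} | v d. v < n \<and> d \<in> D} \<in> regular_graphs n (card D)"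
    (is "?E \<in> _")
proof (rule regular_graphsI)
  have lt: "d < n" "d > 0" if "d \<in> D" for d using D that by force+
  show sub: "e \<subseteq> {..<n}" if "e \<in> ?E" for e using that by auto
  have ne: "v \<noteq> (v + d) mod n" if "v < n" "d \<in> D" for v d
    using that lt[of d] by (auto simp: add_mod_eq_if)
  have "?E \<subseteq> Pow {..<n}" by auto
  then have "finite ?E" using finite_subset by blast
  then show "simple_edges ?E" using ne by (auto simp: simple_edges_def)
  fix v assume v: "v < n"
  have "{u. {u, v} \<in> ?E} = (\<lambda>d. (v + d) mod n) ` D"
  proof (intro subset_antisym subsetI)
    fix u assume "u \<in> {u. {u, v} \<in> ?E}"
    then obtain w d where wd: "{u, v} = {w, (w + d) mod n}" "w < n" "d \<in> D" by auto
    then consider "w = v" "u = (v + d) mod n" | "w = u" "v = (u + d) mod n"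
      by (auto simp: doubleton_eq_iff)
    then show "u \<in> (\<lambda>d. (v + d) mod n) ` D"
    proof cases
      case 2
      then have "u = (v + (n - d)) mod n"
        using wd lt[of d] by (auto simp: add_mod_eq_if split: if_splits)
      then show ?thesis using sym[OF wd(3)] by blast
    qed (use wd in auto)
  qed (use v in \<open>auto simp: insert_commute\<close>)
  moreover have "inj_on (\<lambda>d. (v + d) mod n) D"
  proof (rule inj_onI)
    fix x y assume "x \<in> D" "y \<in> D" "(v + x) mod n = (v + y) mod n"
    then show "x = y" using lt[of x] lt[of y] v by (simp add: add_mod_eq_if split: if_splits)
  qed
  ultimately show "degree ?E v = card D" by (simp add: degree_def card_image)
qed

text \<open>Makes the denominator in \<open>aas_regular\<close> positive; division by 0 would give
  proportion 0. The connection set consists of the steps up to \<open>h\<close> in both directions,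
  with the antipodal step \<open>n div 2\<close> for odd \<open>\<Delta>\<close>, where
  \<open>n\<close> must be even.\<close>

lemma regular_graphs_nonempty:
  assumes "\<Delta> < n" "even (n * \<Delta>)"
  shows "regular_graphs n \<Delta> \<noteq> {}"
proof -
  define h where "h = \<Delta> div 2"
  define D where "D = {1..h} \<union> {n - h..<n} \<union> (if odd \<Delta> then {n div 2} else {})"
  have h: "2 * h < n" using assms by (simp add: h_def)
  have odd: "2 * (n div 2) = n" "\<Delta> = 2 * h + 1" "2 * h + 2 \<le> n" if "odd \<Delta>"
    using that assms by (auto simp: h_def elim!: oddE evenE)
  have "card D = \<Delta>"
  proof (cases "odd \<Delta>")
    case True
    have "D = ({1..h} \<union> {n - h..<n}) \<union> {n div 2}" using True by (simp add: D_def)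
    then have "card D = card ({1..h} \<union> {n - h..<n}) + card {n div 2}"
      using odd[OF True] by (simp only:) (rule card_Un_disjoint; auto)
    also have "card ({1..h} \<union> {n - h..<n}) = card {1..h} + card {n - h..<n}"
      using h by (intro card_Un_disjoint) auto
    finally show ?thesis using odd[OF True] h by simp
  next
    case False
    then have "D = {1..h} \<union> {n - h..<n}" by (simp add: D_def)
    then have "card D = card {1..h} + card {n - h..<n}"
      using h by (simp only:) (rule card_Un_disjoint; auto)
    then show ?thesis using False h by (auto elim!: evenE simp: h_def)
  qed
  moreover have "D \<subseteq> {1..<n}" using h odd by (auto simp: D_def)
  moreover have "n - d \<in> D" if "d \<in> D" for d using that h odd by (auto simp: D_def split: if_splits)
  ultimately show ?thesis using circulant_regular[of D n] by auto
qed

subsection \<open>The union bound\<close>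

lemma power_le_exp_times_fact: "0 \<le> x \<Longrightarrow> x ^ m \<le> exp x * fact m" for x :: real
proof -
  assume x: "0 \<le> x"
  have "(\<Sum>i\<in>{m}. x ^ i /\<^sub>R fact i) \<le> (\<Sum>i. x ^ i /\<^sub>R fact i)"
    using x summable_exp_generic[of x] by (intro sum_le_suminf) auto
  then have "x ^ m / fact m \<le> exp x" by (simp add: exp_def scaleR_conv_of_real field_simps)
  then show ?thesis by (simp add: field_simps)
qed

lemma inverse_fact_le:
  assumes "m > 0"
  shows "1 / fact m \<le> (exp 1 / real m) ^ m"
  using power_le_exp_times_fact[of "real m" m] assms
  by (simp add: power_divide field_simps exp_of_nat_mult[symmetric])

lemma binomial_le_exp_power:
  assumes "k > 0"
  shows "real (n choose k) \<le> (exp 1 * real n / real k) ^ k"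
proof -
  have "real ((n choose k) * fact k) \<le> real (n ^ k)" using binomial_fact_pow by (intro of_nat_mono)
  then have "real (n choose k) \<le> real n ^ k * (1 / fact k)" by (simp add: field_simps)
  also have "\<dots> \<le> real n ^ k * (exp 1 / real k) ^ k"
    using inverse_fact_le[OF assms] by (intro mult_left_mono) auto
  finally show ?thesis by (simp add: power_divide power_mult_distrib mult_ac)
qed

text \<open>The first equation explains the form of \<open>\<beta>\<close>: it turns the base of the
  union bound into a power of \<open>(k / d) / (2 * \<beta>)\<close>, which is near 1/2 when
  \<open>k / d\<close> is near \<open>\<beta>\<close>. The proof writes
  \<open>2 * \<beta> = exp (- X)\<close> and compares exponents.\<close>

lemma beta_identity:
  fixes \<kappa> D \<beta> :: real
  assumes \<kappa>: "1 < \<kappa>" "\<kappa> \<le> D / 2"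
    and \<beta>: "\<beta> = (1 / 2) * exp (- (1 + 2 / (\<kappa> - 1))) * (D / (2 * \<kappa>)) powr (- (1 + 1 / (\<kappa> - 1)))"
  shows "exp 1 * (exp 1 * D / (2 * \<kappa>)) powr \<kappa> = (1 / (2 * \<beta>)) powr (\<kappa> - 1)"
    and "exp 1 * D / (2 * \<kappa>) * \<beta> \<le> 1 / 2" and "0 < \<beta>" and "\<beta> < 1 / 2"
proof -
  define L where "L = ln (D / (2 * \<kappa>))"
  have r: "D / (2 * \<kappa>) \<ge> 1" using \<kappa> by (simp add: field_simps)
  then have L: "L \<ge> 0" by (simp add: L_def)
  have p: "(D / (2 * \<kappa>)) powr x = exp (x * L)" for x using r by (auto simp: powr_def L_def)
  have D: "D / (2 * \<kappa>) = exp L" using r by (simp add: L_def)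
  define X where "X = 1 + 2 / (\<kappa> - 1) + (1 + 1 / (\<kappa> - 1)) * L"
  have "\<beta> = 1 / 2 * exp (- (1 + 2 / (\<kappa> - 1)) + - (1 + 1 / (\<kappa> - 1)) * L)"
    unfolding \<beta> p exp_add by simp
  also have "- (1 + 2 / (\<kappa> - 1)) + - (1 + 1 / (\<kappa> - 1)) * L = - X"
    by (simp add: X_def algebra_simps)
  finally have \<beta>': "\<beta> = 1 / 2 * exp (- X)" .
  show "0 < \<beta>" by (simp add: \<beta>')
  have "(1 + 1 / (\<kappa> - 1)) * L \<ge> 0" using L \<kappa> by (intro mult_nonneg_nonneg) auto
  moreover have "2 / (\<kappa> - 1) > 0" using \<kappa> by simp
  ultimately have "X > 0" unfolding X_def by linarith
  then show "\<beta> < 1 / 2" by (simp add: \<beta>')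
  have eD: "exp 1 * D / (2 * \<kappa>) = exp (1 + L)" using D by (simp add: exp_add flip: times_divide_eq_right)
  have "(\<kappa> - 1) * (2 / (\<kappa> - 1)) = 2" "(\<kappa> - 1) * (1 / (\<kappa> - 1)) = 1" using \<kappa> by (auto simp: field_simps)
  then have X: "(\<kappa> - 1) * X = (\<kappa> - 1) + 2 + ((\<kappa> - 1) + 1) * L"
    by (simp only: X_def distrib_left mult.assoc[symmetric] mult_1_right)
  have "exp 1 * (exp 1 * D / (2 * \<kappa>)) powr \<kappa> = exp (1 + \<kappa> * (1 + L))"
    unfolding eD by (simp add: powr_def flip: exp_add)
  also have "1 + \<kappa> * (1 + L) = (\<kappa> - 1) * X" unfolding X by (simp add: algebra_simps)
  also have "exp ((\<kappa> - 1) * X) = exp X powr (\<kappa> - 1)" by (simp add: powr_def)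
  also have "exp X = 1 / (2 * \<beta>)" by (simp add: \<beta>' exp_minus field_simps)
  finally show "exp 1 * (exp 1 * D / (2 * \<kappa>)) powr \<kappa> = (1 / (2 * \<beta>)) powr (\<kappa> - 1)" .
  have "exp 1 * D / (2 * \<kappa>) * \<beta> = 1 / 2 * exp (1 + L - X)"
    unfolding eD \<beta>' by (simp flip: exp_add)
  also have "1 + L - X = - (2 / (\<kappa> - 1) + L / (\<kappa> - 1))"
    by (simp add: X_def algebra_simps)
  finally have eq: "exp 1 * D / (2 * \<kappa>) * \<beta> = 1 / 2 * exp (- (2 / (\<kappa> - 1) + L / (\<kappa> - 1)))" .
  have "2 / (\<kappa> - 1) + L / (\<kappa> - 1) \<ge> 0" using L \<kappa> by (intro add_nonneg_nonneg) auto
  then have "exp (- (2 / (\<kappa> - 1) + L / (\<kappa> - 1))) \<le> 1" by (simp only: exp_le_one_iff neg_le_0_iff_le)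
  then show "exp 1 * D / (2 * \<kappa>) * \<beta> \<le> 1 / 2" unfolding eq by linarith
qed

text \<open>By \<open>m! \<ge> (m / e) ^ m\<close> the moment bound is at most \<open>y ^ m\<close>,
  and \<open>n choose k \<le> (e * n / k) ^ k\<close>. Everything is then a k-th power, whose base
  \<open>beta_identity\<close> simplifies.\<close>

lemma union_bound_le:
  fixes \<kappa> D \<beta> d :: real and k n :: nat
  assumes \<kappa>: "1 < \<kappa>" "\<kappa> \<le> D / 2"
    and \<beta>: "\<beta> = (1 / 2) * exp (- (1 + 2 / (\<kappa> - 1))) * (D / (2 * \<kappa>)) powr (- (1 + 1 / (\<kappa> - 1)))"
    and k: "k > 0" and d: "d > 0" and y: "exp 1 * D / (2 * \<kappa>) * (k / d) \<le> 1"
  shows "real (n choose k) * ((D * (real k)\<^sup>2 / (2 * d)) ^ nat \<lceil>\<kappa> * k\<rceil> / fact (nat \<lceil>\<kappa> * k\<rceil>))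
    \<le> (n / d * ((k / d) / (2 * \<beta>)) powr (\<kappa> - 1)) ^ k"
proof -
  define m where "m = nat \<lceil>\<kappa> * k\<rceil>"
  define y where "y = exp 1 * D / (2 * \<kappa>) * (k / d)"
  have D: "D > 0" using \<kappa> by simp
  have y01: "0 < y" "y \<le> 1" using y D k d \<kappa> by (auto simp: y_def)
  have pos: "\<kappa> * k > 0" using \<kappa> k by simp
  have m: "real m \<ge> \<kappa> * k" unfolding m_def by (rule real_nat_ceiling_ge)
  then have m0: "m > 0" using pos by (intro gr0I) auto
  have "(D * (real k)\<^sup>2 / (2 * d)) ^ m / fact m = (D * (real k)\<^sup>2 / (2 * d)) ^ m * (1 / fact m)" by simp
  also have "\<dots> \<le> (D * (real k)\<^sup>2 / (2 * d)) ^ m * (exp 1 / real m) ^ m"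
    using inverse_fact_le[OF m0] D d by (intro mult_left_mono) auto
  also have "\<dots> = (D * (real k)\<^sup>2 / (2 * d) * (exp 1 / real m)) ^ m" by (simp only: power_mult_distrib)
  also have "\<dots> \<le> y ^ m"
  proof (rule power_mono)
    have "D * (real k)\<^sup>2 / (2 * d) * (exp 1 / real m) \<le> D * (real k)\<^sup>2 / (2 * d) * (exp 1 / (\<kappa> * k))"
      using m pos m0 D d by (intro mult_left_mono divide_left_mono) auto
    also have "\<dots> = y" using k \<kappa> d by (simp add: y_def field_simps power2_eq_square)
    finally show "D * (real k)\<^sup>2 / (2 * d) * (exp 1 / real m) \<le> y" .
  qed (use D d in auto)
  also have "y ^ m = y powr m" using y01 by (simp add: powr_realpow)
  \<comment> \<open>Rounding \<open>\<kappa> * k\<close> up to \<open>m\<close> only helps because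
    \<open>y \<le> 1\<close>.\<close>
  also have "\<dots> \<le> y powr (\<kappa> * k)" using m y01 by (intro powr_mono') auto
  also have "\<dots> = (y powr \<kappa>) ^ k" using y01 by (simp add: powr_powr flip: powr_realpow)
  finally have "(D * (real k)\<^sup>2 / (2 * d)) ^ m / fact m \<le> (y powr \<kappa>) ^ k" .
  then have "real (n choose k) * ((D * (real k)\<^sup>2 / (2 * d)) ^ m / fact m) \<le>
      (exp 1 * real n / real k) ^ k * (y powr \<kappa>) ^ k"
    using binomial_le_exp_power[OF k] D d by (intro mult_mono) auto
  also have "\<dots> = (exp 1 * real n / real k * y powr \<kappa>) ^ k" by (simp only: power_mult_distrib)
  also have "exp 1 * real n / real k * y powr \<kappa> =
      n / k * (k / d) powr \<kappa> * (exp 1 * (exp 1 * D / (2 * \<kappa>)) powr \<kappa>)"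
    unfolding y_def using D \<kappa> k d by (subst powr_mult) auto
  also have "\<dots> = n / k * (k / d) powr \<kappa> * (1 / (2 * \<beta>)) powr (\<kappa> - 1)"
    by (simp only: beta_identity(1)[OF \<kappa> \<beta>])
  also have "(k / d) powr \<kappa> = (k / d) * (k / d) powr (\<kappa> - 1)"
    using k d by (simp add: powr_diff)
  also have "n / k * ((k / d) * (k / d) powr (\<kappa> - 1)) * (1 / (2 * \<beta>)) powr (\<kappa> - 1) =
      n / d * ((k / d) powr (\<kappa> - 1) * (1 / (2 * \<beta>)) powr (\<kappa> - 1))" using k by simp
  also have "(k / d) powr (\<kappa> - 1) * (1 / (2 * \<beta>)) powr (\<kappa> - 1) = ((k / d) / (2 * \<beta>)) powr (\<kappa> - 1)"
    using k d beta_identity(3)[OF \<kappa> \<beta>] by (subst powr_mult[symmetric]) auto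
  finally show ?thesis by (simp add: m_def)
qed

lemma ceiling_ratio_tendsto:
  fixes \<beta> c :: real
  assumes "\<beta> > 0"
  shows "(\<lambda>n. real n / (real n - c)) \<longlonglongrightarrow> 1"
    and "(\<lambda>n. real (nat \<lceil>\<beta> * real n\<rceil>) / (real n - c)) \<longlonglongrightarrow> \<beta>"
    and "filterlim (\<lambda>n. nat \<lceil>\<beta> * real n\<rceil>) at_top sequentially"
proof -
  let ?k = "\<lambda>n. nat \<lceil>\<beta> * real n\<rceil>"
  show 1: "(\<lambda>n. real n / (real n - c)) \<longlonglongrightarrow> 1" by real_asymp
  have "(\<lambda>n. real (?k n) / real n) \<longlonglongrightarrow> \<beta>"
  proof (rule tendsto_sandwich)
    show "\<forall>\<^sub>F n in sequentially. \<beta> \<le> real (?k n) / real n"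
      using eventually_gt_at_top[of 0] by eventually_elim (simp add: field_simps real_nat_ceiling_ge)
    show "\<forall>\<^sub>F n in sequentially. real (?k n) / real n \<le> \<beta> + 1 / real n"
      using eventually_gt_at_top[of 0]
    proof eventually_elim
      case (elim n)
      have "real (?k n) \<le> \<beta> * real n + 1"
        using assms by (simp add: of_nat_nat)
      then show ?case using elim by (simp add: field_simps)
    qed
    show "(\<lambda>n. \<beta> + 1 / real n) \<longlonglongrightarrow> \<beta>" by real_asymp
  qed simp
  from tendsto_mult[OF this 1] have "(\<lambda>n. real (?k n) / real n * (real n / (real n - c))) \<longlonglongrightarrow> \<beta>" by simp
  then show "(\<lambda>n. real (?k n) / (real n - c)) \<longlonglongrightarrow> \<beta>"
    by (rule Lim_transform_eventually)
      (use eventually_gt_at_top[of 0] in \<open>eventually_elim, simp\<close>)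
  have "filterlim (\<lambda>n. \<beta> * real n) at_top sequentially" using assms by real_asymp
  then have "filterlim (\<lambda>n. real (?k n)) at_top sequentially"
    by (rule filterlim_at_top_mono) (simp add: real_nat_ceiling_ge)
  then show "filterlim ?k at_top sequentially"
    by (simp add: filterlim_sequentially_iff_filterlim_real)
qed

text \<open>The base tends to \<open>(1 / 2) powr (\<kappa> - 1) < 1\<close> while the exponent
  tends to infinity.\<close>

lemma union_bound_tendsto:
  fixes \<kappa> D \<beta> c :: real
  assumes \<kappa>: "1 < \<kappa>" and \<beta>: "0 < \<beta>"
  shows "(\<lambda>n. (n / (real n - c) * ((nat \<lceil>\<beta> * real n\<rceil> / (real n - c)) / (2 * \<beta>)) powr (\<kappa> - 1))
    ^ nat \<lceil>\<beta> * real n\<rceil>) \<longlonglongrightarrow> 0"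
proof -
  let ?k = "\<lambda>n. nat \<lceil>\<beta> * real n\<rceil>"
  let ?f = "\<lambda>n. n / (real n - c) * ((?k n / (real n - c)) / (2 * \<beta>)) powr (\<kappa> - 1)"
  note lim = ceiling_ratio_tendsto[OF \<beta>]
  have "?f \<longlonglongrightarrow> 1 * (\<beta> / (2 * \<beta>)) powr (\<kappa> - 1)"
    using \<beta> by (intro tendsto_intros lim) auto
  then have f: "?f \<longlonglongrightarrow> (1 / 2) powr (\<kappa> - 1)" using \<beta> by simp
  have "(1 / 2) powr (\<kappa> - 1) < (1 / 2 :: real) powr 0" using \<kappa> by (intro powr_less_mono') auto
  then obtain r where r: "(1 / 2) powr (\<kappa> - 1) < r" "r < 1" using dense by auto
  have r0: "0 < r" using r(1) by (rule less_trans[rotated]) simp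
  have "(\<lambda>n. r ^ n) \<longlonglongrightarrow> 0" using r r0 by (intro LIMSEQ_power_zero) simp
  then have pow: "(\<lambda>n. r ^ ?k n) \<longlonglongrightarrow> 0" using lim(3) by (rule filterlim_compose)
  have nonneg: "eventually (\<lambda>n. 0 \<le> ?f n) sequentially"
    using eventually_gt_at_top[of "nat \<lceil>c\<rceil>"]
  proof eventually_elim
    case (elim n)
    then have "c < real n" by linarith
    then show ?case by (intro mult_nonneg_nonneg) auto
  qed
  have "eventually (\<lambda>n. ?f n < r) sequentially" using f r(1) by (rule order_tendstoD(2))
  then have upper: "eventually (\<lambda>n. ?f n ^ ?k n \<le> r ^ ?k n) sequentially"
    using nonneg by eventually_elim (intro power_mono, auto)
  have lower: "eventually (\<lambda>n. 0 \<le> ?f n ^ ?k n) sequentially"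
    using nonneg by eventually_elim (rule zero_le_power)
  show ?thesis by (rule tendsto_sandwich[OF lower upper tendsto_const pow])
qed

section \<open>From sparsity to the theorem\<close>

lemma mixing_time_ge_of_sparse:
  fixes lam \<kappa> \<beta> :: real
  assumes E: "E \<in> regular_graphs n \<Delta>" and lam: "lam \<ge> 1" and \<kappa>: "0 < \<kappa>" "\<kappa> \<le> real \<Delta> / 2"
    and \<beta>: "0 < \<beta>" "\<beta> \<le> 1" and q: "q \<ge> 2"
    and Q: "real q - 1 \<le> \<beta>\<^sup>2 / (256 * (exp 1)\<^sup>2) * lam powr (real \<Delta> - \<kappa> - \<kappa>\<^sup>2 / (real \<Delta> - \<kappa>))"
    and k: "\<beta> * real n \<le> real k" "0 < k" "2 * k < n"
    and sparse: "\<And>U. U \<subseteq> {..<n} \<Longrightarrow> card U = k \<Longrightarrow> real (card (inner_edges E U)) \<le> \<kappa> * real k"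
  shows "mixing_time n E lam q \<ge> ereal (2 powr (\<beta> * real n - 4))"
proof -
  let ?r = "real (n choose k) * (\<beta> / (8 * exp 1)) ^ k"
  have "?r \<le> (exp 1 * real n / real k) ^ k * (\<beta> / (8 * exp 1)) ^ k"
    using binomial_le_exp_power[OF k(2)] \<beta> by (intro mult_right_mono) auto
  also have "\<dots> = (\<beta> * real n / real k / 8) ^ k"
  proof -
    have "exp 1 * real n / real k * (\<beta> / (8 * exp 1)) = \<beta> * real n / real k / 8" by simp
    then show ?thesis by (simp only: flip: power_mult_distrib)
  qed
  \<comment> \<open>Rounding up gives \<open>\<beta> * n \<le> k\<close>, so the binomial
    coefficient is absorbed; \<open>8 ^ k\<close> then outweighs the claimed time
    \<open>2 ^ k / 16\<close>.\<close>
  also have "\<dots> \<le> (1 / 8) ^ k" using k \<beta> by (intro power_mono divide_right_mono) auto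
  finally have r: "?r \<le> (1 / 8) ^ k" .
  have "2 powr (\<beta> * real n - 4) * ?r \<le> 2 powr (real k - 4) * (1 / 8) ^ k"
    using r k \<beta> by (intro mult_mono powr_mono) auto
  also have "\<dots> = (1 / 16) * (2 ^ k * (1 / 8) ^ k)" by (simp add: powr_diff powr_realpow)
  also have "2 ^ k * (1 / 8) ^ k = (1 / 4 :: real) ^ k" by (simp flip: power_mult_distrib)
  also have "(1 / 16) * \<dots> \<le> 1 / 16 * (1 :: real)" by (intro mult_left_mono power_le_one) auto
  finally have T: "2 powr (\<beta> * real n - 4) * ?r \<le> 1 / 16" by simp
  show ?thesis
    using mixing_time_ge[OF E lam q k(2,3) bottleneck_weight_le[OF E lam \<kappa> \<beta> q Q sparse] T] by simp
qed

theorem theorem4p4: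
  fixes \<Delta> q :: nat and lam \<kappa> \<beta> :: real
  assumes "\<Delta> \<ge> 3" and "lam \<ge> 1"
    and "1 < \<kappa>" and "\<kappa> \<le> real \<Delta> / 2"
    and "\<beta> = (1 / 2) * exp (- (1 + 2 / (\<kappa> - 1)))
                 * (real \<Delta> / (2 * \<kappa>)) powr (- (1 + 1 / (\<kappa> - 1)))"
    and "q \<ge> 2"
    and "real q - 1 \<le> \<beta>\<^sup>2 / (256 * (exp 1)\<^sup>2)
                 * lam powr (real \<Delta> - \<kappa> - \<kappa>\<^sup>2 / (real \<Delta> - \<kappa>))"
  shows "aas_regular \<Delta> (\<lambda>n E. mixing_time n E lam q \<ge> ereal (2 powr (\<beta> * real n - 4)))"
  unfolding aas_regular_def
proof (intro allI impI)
  fix \<epsilon> :: real assume \<epsilon>: "\<epsilon> > 0"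
  let ?P = "\<lambda>n E. mixing_time n E lam q \<ge> ereal (2 powr (\<beta> * real n - 4))"
  \<comment> \<open>The loss per switching: \<open>\<Delta> * c\<close> darts are spoilt by the
    neighbourhoods of \<open>u\<close> and \<open>v\<close>.\<close>
  define c where "c = 2 * (real \<Delta> + 1)"
  define k where "k n = nat \<lceil>\<beta> * real n\<rceil>" for n :: nat
  let ?p = "\<lambda>n. (n / (real n - c) * ((k n / (real n - c)) / (2 * \<beta>)) powr (\<kappa> - 1)) ^ k n"
  note \<beta> = beta_identity(2-4)[OF assms(3-5)]
  note lim = ceiling_ratio_tendsto[OF \<beta>(2), folded k_def]
  have "eventually (\<lambda>n. ?p n < \<epsilon>) sequentially"
    using union_bound_tendsto[OF assms(3) \<beta>(2), of c] \<epsilon> unfolding k_def by (rule order_tendstoD(2))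
  moreover have "eventually (\<lambda>n. exp 1 * real \<Delta> / (2 * \<kappa>) * (k n / (real n - c)) < 1) sequentially"
  proof (rule order_tendstoD(2))
    show "(\<lambda>n. exp 1 * real \<Delta> / (2 * \<kappa>) * (k n / (real n - c))) \<longlonglongrightarrow> exp 1 * real \<Delta> / (2 * \<kappa>) * \<beta>"
      by (intro tendsto_intros lim)
  qed (rule le_less_trans[OF \<beta>(1)], simp)
  moreover have "eventually (\<lambda>n. k n / (real n - c) < 1) sequentially"
    by (rule order_tendstoD(2)[OF lim(2)]) (use \<beta> in simp)
  \<comment> \<open>The same limit with \<open>c = 0\<close>; it yields \<open>2 * k n < n\<close>,
    needed for the colour exchange.\<close>
  moreover have "eventually (\<lambda>n. k n / (real n - 0) < 1 / 2) sequentially"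
    using lim(2) \<beta>(3) by (rule order_tendstoD(2))
  moreover have "eventually (\<lambda>n. n > max \<Delta> (nat \<lceil>c\<rceil>)) sequentially" by (rule eventually_gt_at_top)
  ultimately have "eventually (\<lambda>n. even (n * \<Delta>) \<longrightarrow>
      real (card {E \<in> regular_graphs n \<Delta>. ?P n E}) / real (card (regular_graphs n \<Delta>)) \<ge> 1 - \<epsilon>) sequentially"
  proof eventually_elim
    case (elim n)
    let ?R = "regular_graphs n \<Delta>"
    let ?m = "nat \<lceil>\<kappa> * k n\<rceil>"
    let ?bad = "{E \<in> ?R. \<exists>U\<subseteq>{..<n}. card U = k n \<and> card (inner_edges E U) \<ge> ?m}"
    have nc: "c < real n" and n\<Delta>: "\<Delta> < n" using elim(5) by linarith+
    have kn: "\<beta> * real n \<le> real (k n)" unfolding k_def by (rule real_nat_ceiling_ge)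
    have "\<beta> * real n > 0" using \<beta> n\<Delta> by simp
    then have k0: "k n > 0" using kn by (intro gr0I) auto
    have k2: "2 * k n < n" using elim(4) n\<Delta> by (simp add: field_simps)
    have kc: "real (k n) < real n - c" using elim(3) nc by (simp add: field_simps)
    \<comment> \<open>Below the ceiling \<open>j < \<kappa> * k n\<close>, and
      \<open>\<kappa> \<le> \<Delta> / 2\<close> keeps the free degree nonnegative in every moment
      step.\<close>
    have m: "2 * j \<le> \<Delta> * k n" if "j < ?m" for j
    proof -
      have "real j < \<kappa> * k n" using that by linarith
      also have "\<dots> \<le> real \<Delta> / 2 * k n" using assms(4) by (intro mult_right_mono) auto
      finally have "real (2 * j) < real (\<Delta> * k n)" by simp
      then show ?thesis by linarith
    qed
    show ?case
    proof
      assume "even (n * \<Delta>)"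
      then have R: "real (card ?R) > 0"
        using regular_graphs_nonempty[OF n\<Delta>] finite_regular_graphs by (simp add: card_gt_0_iff)
      have "real (card ?bad) \<le> real (n choose k n) *
          ((real \<Delta> * (real (k n))\<^sup>2 / (2 * (real n - c))) ^ ?m / fact ?m) * card ?R"
        using card_dense_graphs_le[of \<Delta> "k n" n ?m] kc m assms(1) by (simp add: c_def)
      also have "\<dots> \<le> ?p n * card ?R"
        using union_bound_le[OF assms(3-5) k0, of "real n - c" n] elim(2) nc by (intro mult_right_mono) auto
      also have "\<dots> \<le> \<epsilon> * card ?R" using elim(1) by (intro mult_right_mono) auto
      finally have bad: "real (card ?bad) \<le> \<epsilon> * card ?R" .
      have "?R - ?bad \<subseteq> {E \<in> ?R. ?P n E}"
      proof
        fix E assume E: "E \<in> ?R - ?bad"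
        have "real (card (inner_edges E U)) \<le> \<kappa> * real (k n)" if "U \<subseteq> {..<n}" "card U = k n" for U
        proof (rule ccontr)
          assume "\<not> real (card (inner_edges E U)) \<le> \<kappa> * real (k n)"
          then have "?m \<le> card (inner_edges E U)" by linarith
          then show False using E that by blast
        qed
        then have "?P n E"
          using E assms \<beta> kn k0 k2 by (intro mixing_time_ge_of_sparse[of E n \<Delta> lam \<kappa> \<beta> q "k n"]) auto
        then show "E \<in> {E \<in> ?R. ?P n E}" using E by blast
      qed
      then have "card (?R - ?bad) \<le> card {E \<in> ?R. ?P n E}"
        using finite_regular_graphs by (intro card_mono) auto
      moreover have "card (?R - ?bad) = card ?R - card ?bad" "card ?bad \<le> card ?R"
        using finite_regular_graphs by (auto intro!: card_Diff_subset card_mono)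
      ultimately have "real (card ?R) - real (card ?bad) \<le> real (card {E \<in> ?R. ?P n E})" by linarith
      with bad have "(1 - \<epsilon>) * card ?R \<le> real (card {E \<in> ?R. ?P n E})" by (simp add: algebra_simps)
      then show "real (card {E \<in> ?R. ?P n E}) / real (card ?R) \<ge> 1 - \<epsilon>" using R by (simp add: field_simps)
    qed
  qed
  then show "\<exists>N. \<forall>n\<ge>N. even (n * \<Delta>) \<longrightarrow>
      real (card {E \<in> regular_graphs n \<Delta>. ?P n E}) / real (card (regular_graphs n \<Delta>)) \<ge> 1 - \<epsilon>"
    by (simp add: eventually_sequentially)
qed

end
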